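(* Let $K$ be a field, $R = K[x_1,x_2,\ldots]$, and let $I = \langle f_1, \ldots, f_m\rangle_{R[\mathfrak{S}_{\infty}]}$ be the symmetric ideal of $R$ generated by polynomials $f_1,\ldots,f_m \in R$. Then there is a computable, finite set of polynomials $G \subseteq R$ (that is, a finite set that can be computed by an algorithm from the input $f_1,\ldots,f_m$) such that for every polynomial $f \in R$, we have $f \in I$ if and only if the polynomial reduction of $f$ with $G$ is $0$ (that is, $f$ has normal form $0$ with respect to $G$).
   Context: Setting. $K$ is a field, $X=\{x_1,x_2,\ldots\}$ is an infinite set of indeterminates indexed by the positive integers, $R=K[X]$. $\mathfrak{S}_\infty$ is the group of all permutations of $X$ (equivalently, of the positive integers); it acts on $R$ by $\sigma f(x_1,\ldots,x_n)=f(x_{\sigma 1},\ldots,x_{\sigma n})$. $R[\mathfrak{S}_\infty]$ is the left group ring with multiplication $f\sigma\cdot g\tau = fg(\sigma\tau)$ for $f,g\in R$, $\sigma,\tau\in\mathfrak{S}_\infty$, extended linearly; $R$ is a left $R[\mathfrak{S}_\infty]$-module via the action above. An ideal $I\subseteq R$ is symmetric if $\sigma f\in I$ for all $\sigma\in\mathfrak{S}_\infty$, $f\in I$; symmetric ideals are exactly the $R[\mathfrak{S}_\infty]$-submodules of $R$. $\langle f_1,\ldots,f_m\rangle_{R[\mathfrak{S}_\infty]}$ denotes the $R[\mathfrak{S}_\infty]$-submodule generated by $f_1,\ldots,f_m$, i.e. the ideal of $R$ generated by all $\sigma f_i$. "Computable" refers to algorithms that operate on polynomials with coefficients in $K$,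 using the field operations and equality test of $K$. Monomial orders. $\Omega$ is the set of monomials in $x_1,x_2,\ldots$, including $1$. Order $x_1<x_2<\cdots$ and let $\leq$ be the induced lexicographic total well-ordering of $\Omega$ (two distinct monomials are compared by their exponents at the largest index where the exponents differ). For nonzero $f\in R$, $\operatorname{lm}(f)$ and $\operatorname{lt}(f)$ are its leading monomial and leading term with respect to $\leq$. The symmetric cancellation partial ordering on $\Omega$: $v\preceq w$ if and only if $v\leq w$ and there exists $\sigma\in\mathfrak{S}_\infty$ such that $\sigma v\mid w$ and $\sigma u\leq\sigma v$ for all $u\in\Omega$ with $u\leq v$; such a $\sigma$ is said to witness $v\preceq w$. Reduction. Let $B$ be a set of nonzero polynomials in $R$ and let $f\in R$, $f\ne 0$. $f$ is reducible by $B$ if there exists $g\in B$ with $\operatorname{lm}(g)\preceq\operatorname{lm}(f)$, witnessed by some $\sigma\in\mathfrak{S}_\infty$, and $\operatorname{lt}(f)=a\,w\,\sigma\operatorname{lt}(g)$ for some nonzero $a\in K$ and $w\in\Omega$ such that $w\,\sigma\operatorname{lm}(g)=\operatorname{lm}(f)$; in this case one writes $f\to_B h$ where $h=f-a w\,\sigma g$. $f$ is reduced with respect to $B$ if it is not reducible by $B$; the zero polynomial is reduced by convention. Let $\to_B^*$ be the smallest quasi-ordering (reflexive transitive relation) on $R$ extending $\to_B$. A normal form of $f$ with respect to $B$ is an $r\in R$ that is reduced with respect to $B$ and satisfies $f\to_B^* r$. *)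

theory Defs
  imports Complex_Main "HOL-Library.Poly_Mapping"
begin

section \<open>Polynomials in infinitely many indeterminates\<close>

text \<open>Monomials are written additively, as finitely supported exponent functions; the
  index \<open>i\<close> (starting at \<open>0\<close>) stands for the indeterminate \<open>x\<^sub>i\<^sub>+\<^sub>1\<close>.  The product of
  monomials is \<open>+\<close>, and \<open>0\<close> is the monomial \<open>1\<close>.\<close>

type_synonym mon = "nat \<Rightarrow>\<^sub>0 nat"
type_synonym 'k rpoly = "mon \<Rightarrow>\<^sub>0 'k"

definition perm_mon :: "(nat \<Rightarrow> nat) \<Rightarrow> mon \<Rightarrow> mon" where
  "perm_mon \<sigma> t = (\<Sum>i\<in>Poly_Mapping.keys t. Poly_Mapping.single (\<sigma> i) (Poly_Mapping.lookup t i))"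

definition perm_poly :: "(nat \<Rightarrow> nat) \<Rightarrow> 'k::comm_ring_1 rpoly \<Rightarrow> 'k rpoly" where
  "perm_poly \<sigma> f =
     (\<Sum>t\<in>Poly_Mapping.keys f. Poly_Mapping.single (perm_mon \<sigma> t) (Poly_Mapping.lookup f t))"

text \<open>\<open>module.subspace (*)\<close> is the predicate ``is an ideal'' on a commutative ring.\<close>

definition symmetric_ideal :: "'k::comm_ring_1 rpoly set \<Rightarrow> bool" where
  "symmetric_ideal I \<longleftrightarrow>
     module.subspace (*) I \<and> (\<forall>\<sigma>. bij \<sigma> \<longrightarrow> (\<forall>f\<in>I. perm_poly \<sigma> f \<in> I))"

definition symmetric_ideal_of :: "'k::comm_ring_1 rpoly set \<Rightarrow> 'k rpoly set" where
  "symmetric_ideal_of F = symmetric_ideal hull F"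


section \<open>Monomial order, symmetric cancellation and reduction\<close>

text \<open>The order compares exponents at the \<^emph>\<open>largest\<close> index where they differ.  The library's
  linear order on \<open>nat \<Rightarrow>\<^sub>0 nat\<close> uses the smallest such index and is not the one wanted here.\<close>

definition mon_less :: "mon \<Rightarrow> mon \<Rightarrow> bool" where
  "mon_less v w \<longleftrightarrow> (\<exists>i. Poly_Mapping.lookup v i < Poly_Mapping.lookup w i \<and>
                        (\<forall>j>i. Poly_Mapping.lookup v j = Poly_Mapping.lookup w j))"

definition mon_le :: "mon \<Rightarrow> mon \<Rightarrow> bool" where
  "mon_le v w \<longleftrightarrow> v = w \<or> mon_less v w"

definition mon_dvd :: "mon \<Rightarrow> mon \<Rightarrow> bool" where
  "mon_dvd v w \<longleftrightarrow> (\<exists>t. w = t + v)"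

definition lm :: "'k::field rpoly \<Rightarrow> mon" where
  "lm f = (THE t. t \<in> Poly_Mapping.keys f \<and> (\<forall>u\<in>Poly_Mapping.keys f. mon_le u t))"

definition lt :: "'k::field rpoly \<Rightarrow> 'k rpoly" where
  "lt f = Poly_Mapping.single (lm f) (Poly_Mapping.lookup f (lm f))"

definition witnesses :: "(nat \<Rightarrow> nat) \<Rightarrow> mon \<Rightarrow> mon \<Rightarrow> bool" where
  "witnesses \<sigma> v w \<longleftrightarrow> mon_le v w \<and> bij \<sigma> \<and> mon_dvd (perm_mon \<sigma> v) w \<and>
     (\<forall>u. mon_le u v \<longrightarrow> mon_le (perm_mon \<sigma> u) (perm_mon \<sigma> v))"

definition reduces :: "'k::field rpoly set \<Rightarrow> 'k rpoly \<Rightarrow> 'k rpoly \<Rightarrow> bool" where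
  "reduces B f h \<longleftrightarrow> f \<noteq> 0 \<and> (\<exists>g\<in>B. \<exists>\<sigma> a w.
     witnesses \<sigma> (lm g) (lm f) \<and> a \<noteq> 0 \<and>
     lt f = Poly_Mapping.single w a * perm_poly \<sigma> (lt g) \<and>
     w + perm_mon \<sigma> (lm g) = lm f \<and>
     h = f - Poly_Mapping.single w a * perm_poly \<sigma> g)"

definition reduced :: "'k::field rpoly set \<Rightarrow> 'k rpoly \<Rightarrow> bool" where
  "reduced B f \<longleftrightarrow> \<not> (\<exists>h. reduces B f h)"

definition normal_form :: "'k::field rpoly set \<Rightarrow> 'k rpoly \<Rightarrow> 'k rpoly \<Rightarrow> bool" where
  "normal_form B f r \<longleftrightarrow> reduced B r \<and> (reduces B)\<^sup>*\<^sup>* f r"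


section \<open>Algorithms over a field\<close>

text \<open>Computability over a field \<open>K\<close> that is accessible only through its field operations and
  its equality test is rendered by while-programs over finite binary trees whose leaves carry
  natural numbers or elements of \<open>K\<close>.  Programs are finite objects, and since the type of
  programs does not mention \<open>K\<close>, no element of \<open>K\<close> other than \<open>0\<close> and \<open>1\<close> can be built
  into a program.  Truth values are natural numbers, with \<open>0\<close> as false.\<close>

datatype 'k val = VNat nat | VElem 'k | VPair "'k val" "'k val"

datatype prog =
    Ident | First | Second | Fork prog prog
  | Seq prog prog | Cond prog prog prog | While prog prog
  | IsPair | Zero | Succ | Pred
  | FZero | FOne | FAdd | FNeg | FMul | FInv | FEq

text \<open>\<open>exec p x y\<close>: on input \<open>x\<close> the program \<open>p\<close> halts with output \<open>y\<close>.  An operation applied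
  outside its domain (such as inverting \<open>0\<close>) is stuck.\<close>

inductive exec :: "prog \<Rightarrow> 'k::field val \<Rightarrow> 'k val \<Rightarrow> bool" where
  "exec Ident x x"
| "exec First (VPair x y) x"
| "exec Second (VPair x y) y"
| "exec p x y \<Longrightarrow> exec q x z \<Longrightarrow> exec (Fork p q) x (VPair y z)"
| "exec p x y \<Longrightarrow> exec q y z \<Longrightarrow> exec (Seq p q) x z"
| "exec b x (VNat n) \<Longrightarrow> n \<noteq> 0 \<Longrightarrow> exec p x y \<Longrightarrow> exec (Cond b p q) x y"
| "exec b x (VNat 0) \<Longrightarrow> exec q x y \<Longrightarrow> exec (Cond b p q) x y"
| "exec b x (VNat 0) \<Longrightarrow> exec (While b p) x x"
| "exec b x (VNat n) \<Longrightarrow> n \<noteq> 0 \<Longrightarrow> exec p x y \<Longrightarrow> exec (While b p) y z \<Longrightarrow> exec (While b p) x z"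
| "exec IsPair (VPair x y) (VNat 1)"
| "exec IsPair (VNat n) (VNat 0)"
| "exec IsPair (VElem a) (VNat 0)"
| "exec Zero x (VNat 0)"
| "exec Succ (VNat n) (VNat (n + 1))"
| "exec Pred (VNat n) (VNat (n - 1))"
| "exec FZero x (VElem 0)"
| "exec FOne x (VElem 1)"
| "exec FAdd (VPair (VElem a) (VElem b)) (VElem (a + b))"
| "exec FNeg (VElem a) (VElem (- a))"
| "exec FMul (VPair (VElem a) (VElem b)) (VElem (a * b))"
| "a \<noteq> 0 \<Longrightarrow> exec FInv (VElem a) (VElem (inverse a))"
| "exec FEq (VPair (VElem a) (VElem b)) (VNat (if a = b then 1 else 0))"

inductive_cases exec_ForkE: "exec (Fork p q) x z"
inductive_cases exec_SeqE: "exec (Seq p q) x z"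
inductive_cases exec_CondE: "exec (Cond b p q) x z"
inductive_cases exec_WhileE: "exec (While b p) x z"

lemma exec_deterministic: "exec p x y \<Longrightarrow> exec p x z \<Longrightarrow> y = z"
proof (induction arbitrary: z rule: exec.induct)
  case (4 p x y q y')
  from 4(5) show ?case by (rule exec_ForkE) (use 4 in auto)
next
  case (5 p x y q y')
  from 5(5) show ?case by (rule exec_SeqE) (use 5 in metis)
next
  case (6 b x n p y q)
  from 6(6) show ?case
  proof (rule exec_CondE)
    show "exec p x z \<Longrightarrow> y = z" by (rule "6.IH"(2))
    show "exec b x (VNat 0) \<Longrightarrow> y = z" using "6.IH"(1)[of "VNat 0"] "6.hyps" by simp
  qed
next
  case (7 b x q y p)
  from 7(5) show ?case
  proof (rule exec_CondE)
    show "exec b x (VNat n) \<Longrightarrow> 0 < n \<Longrightarrow> y = z" for n using "7.IH"(1)[of "VNat n"] by simp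
    show "exec q x z \<Longrightarrow> y = z" by (rule "7.IH"(2))
  qed
next
  case (8 b x p)
  from 8(3) show ?case
  proof (rule exec_WhileE)
    show "z = x \<Longrightarrow> x = z" by simp
    show "exec b x (VNat n) \<Longrightarrow> 0 < n \<Longrightarrow> x = z" for n using "8.IH"[of "VNat n"] by simp
  qed
next
  case (9 b x n p y y')
  from 9(8) show ?case
  proof (rule exec_WhileE)
    show "exec b x (VNat 0) \<Longrightarrow> y' = z" using "9.IH"(1)[of "VNat 0"] "9.hyps" by simp
    show "exec p x u \<Longrightarrow> exec (While b p) u z \<Longrightarrow> y' = z" for u using "9.IH"(2)[of u] "9.IH"(3) by simp
  qed
qed (erule exec.cases; simp; fail)+


text \<open>A polynomial is presented by any list of terms (coefficient, list of exponents of
  \<open>x\<^sub>1, x\<^sub>2, \<dots>\<close>) whose sum it is; zero coefficients, repeated monomials and trailing zero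
  exponents are permitted.\<close>

fun list_val :: "'k val list \<Rightarrow> 'k val" where
  "list_val [] = VNat 0"
| "list_val (x # xs) = VPair x (list_val xs)"

definition term_val :: "'k \<times> nat list \<Rightarrow> 'k val" where
  "term_val = (\<lambda>(c, es). VPair (VElem c) (list_val (map VNat es)))"

definition poly_of_terms :: "('k::field \<times> nat list) list \<Rightarrow> 'k rpoly" where
  "poly_of_terms ts = (\<Sum>(c, es)\<leftarrow>ts. Poly_Mapping.single (Poly_Mapping.nth es) c)"

definition encodes_poly :: "'k::field val \<Rightarrow> 'k rpoly \<Rightarrow> bool" where
  "encodes_poly v f \<longleftrightarrow> (\<exists>ts. v = list_val (map term_val ts) \<and> f = poly_of_terms ts)"

definition encodes_polys :: "'k::field val \<Rightarrow> 'k rpoly list \<Rightarrow> bool" where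
  "encodes_polys v fs \<longleftrightarrow> (\<exists>vs. v = list_val vs \<and> list_all2 encodes_poly vs fs)"

lemma ex_encodes_poly: "\<exists>v. encodes_poly v f"
proof -
  have mon: "\<exists>es. t = Poly_Mapping.nth es" for t :: mon
  proof -
    obtain n where n: "\<forall>i\<in>Poly_Mapping.keys t. i < n"
      using finite_keys[of t] finite_nat_set_iff_bounded by metis
    have "t = Poly_Mapping.nth (map (Poly_Mapping.lookup t) [0..<n])"
      by (rule poly_mapping_eqI)
        (use n in \<open>auto simp: nth.rep_eq nth_default_def in_keys_iff\<close>)
    then show ?thesis ..
  qed
  obtain m where m: "\<And>t :: mon. t = Poly_Mapping.nth (m t)"
    using mon by metis
  obtain xs where xs: "set xs = Poly_Mapping.keys f" "distinct xs"
    using finite_distinct_list[of "Poly_Mapping.keys f"] by auto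
  define ts where "ts = map (\<lambda>t. (Poly_Mapping.lookup f t, m t)) xs"
  have "poly_of_terms ts = (\<Sum>t\<leftarrow>xs. Poly_Mapping.single t (Poly_Mapping.lookup f t))"
    by (simp add: poly_of_terms_def ts_def o_def m[symmetric])
  also have "\<dots> = (\<Sum>t\<in>Poly_Mapping.keys f. Poly_Mapping.single t (Poly_Mapping.lookup f t))"
    using xs by (simp add: sum_list_distinct_conv_sum_set)
  also have "\<dots> = f"
    by (rule poly_mapping_eqI)
      (auto simp: lookup_sum lookup_single when_def in_keys_iff)
  finally show ?thesis
    unfolding encodes_poly_def by metis
qed

lemma ex_encodes_polys: "\<exists>v. encodes_polys v (fs :: 'k::field rpoly list)"
proof -
  obtain e where "\<And>f :: 'k rpoly. encodes_poly (e f) f"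
    using ex_encodes_poly by metis
  then have "list_all2 encodes_poly (map e fs) fs"
    by (simp add: list_all2_conv_all_nth)
  then show ?thesis
    unfolding encodes_polys_def by blast
qed

end

theory Submission
  imports Defs "HOL-Library.Sublist" "HOL-Library.Infinite_Set" "HOL-Library.While_Combinator"
begin

text \<open>The lexicographic order is preserved by strictly increasing maps of the indeterminates, and the
  leading monomial of a polynomial contains its largest indeterminate; hence a strictly increasing
  map that carries \<open>lm g\<close> to a divisor of \<open>lm f\<close> extends to a witness of symmetric cancellation.

  Buchberger's criterion is applied to the infinite set of all images of the generators under
  injections.  If the generators use \<open>N\<close> indeterminates, every pair of images comes by a strictly
  increasing map from a pair of images under injections of \<open>{..<N}\<close> into \<open>{..<2 * N}\<close>, so finitely many
  S-polynomials have to be divided.  The completion adds the nonzero remainders until there are none.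
  By Higman's lemma on words of exponents this stops, because the leading monomials of remainders
  found in different rounds would otherwise form a bad sequence.  The result contains all images of
  its generators under permutations of their \<open>N\<close> indeterminates, and every injection is such a
  permutation followed by a strictly increasing map; so witnesses exist whenever they are needed.\<close>


section \<open>Higman's lemma for words of natural numbers\<close>

text \<open>Two kinds of maps have to be reconciled. Leading monomials commute with strictly
  increasing maps, which are in general not bijective, whereas the ideal and the reduction are
  stated with permutations, which may reorder indeterminates. Extending a bounded piece of an
  injection to a permutation links the two. The number 2N bounds the indices in the union of two
  images of {..<N}; a pair needs that much room, a single reducer only N. Remainders may involve 2N
  indeterminates, so the bound N may grow from round to round and no fixed Noetherian polynomial
  ring is available. For the same reason, divisibility of leading monomials up to a strictly
  increasing map is not by itself enough for termination: the map must also keep its relevant values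
  inside the range of the current round, which is why Higman's lemma is carried over to monomials
  together with a bound on these values. In the algorithm no field element is inverted:
  S-polynomials are cross-multiplied and serve also as division steps.\<close>

abbreviation (input) bad :: "('a \<Rightarrow> 'a \<Rightarrow> bool) \<Rightarrow> (nat \<Rightarrow> 'a) \<Rightarrow> bool" where
  "bad P f \<equiv> \<forall>i j. i < j \<longrightarrow> \<not> P (f i) (f j)"

text \<open>Minimal bad sequences of Nash-Williams. Entries are fixed one at a time: among the bad
  sequences sharing the prefix fixed so far, one with the smallest next entry is kept, and the
  diagonal of these choices is the result.\<close>

lemma ex_minimal_bad_seq:
  fixes size :: "'a \<Rightarrow> nat"
  assumes "bad P f0"
  obtains f where "bad P f"
    "\<And>k g. bad P g \<Longrightarrow> (\<And>i. i < k \<Longrightarrow> g i = f i) \<Longrightarrow> size (f k) \<le> size (g k)"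
proof -
  define Q where "Q n F \<longleftrightarrow> bad P F \<and>
    (\<forall>k<n. \<forall>g. bad P g \<longrightarrow> (\<forall>i<k. g i = F i) \<longrightarrow> size (F k) \<le> size (g k))" for n F
  have step: "\<exists>F'. Q (Suc n) F' \<and> (\<forall>i<n. F' i = F i)" if "Q n F" for n F
  proof -
    define C where "C g \<longleftrightarrow> bad P g \<and> (\<forall>i<n. g i = F i)" for g
    have "C F" using that by (auto simp: C_def Q_def)
    then obtain F' where F': "C F'" "\<And>g. C g \<Longrightarrow> size (F' n) \<le> size (g n)"
      using ex_has_least_nat[of C F "\<lambda>g. size (g n)"] by auto
    have "Q (Suc n) F'"
      unfolding Q_def
    proof (intro conjI allI impI)
      show "\<not> P (F' i) (F' j)" if "i < j" for i j using F'(1) that by (auto simp: C_def)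
      fix k g assume k: "k < Suc n" and g: "bad P g" and agree: "\<forall>i<k. g i = F' i"
      show "size (F' k) \<le> size (g k)"
      proof (cases "k = n")
        case True
        then show ?thesis using F' g agree by (auto simp: C_def)
      next
        case False
        then have "k < n" using k by simp
        moreover have "\<forall>i\<le>k. F' i = F i" using F'(1) \<open>k < n\<close> by (auto simp: C_def)
        ultimately show ?thesis using that g agree unfolding Q_def by (metis order_refl less_imp_le)
      qed
    qed
    then show ?thesis using F'(1) by (auto simp: C_def)
  qed
  have "\<exists>F. \<forall>n. Q n (F n) \<and> (\<forall>i<n. F (Suc n) i = F n i)"
    by (rule dependent_nat_choice) (use assms step in \<open>auto simp: Q_def\<close>)
  then obtain F where F: "\<And>n. Q n (F n)" "\<And>n i. i < n \<Longrightarrow> F (Suc n) i = F n i" by blast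
  have stable: "F m i = F (Suc i) i" if "i < m" for m i
    using that
  proof (induction m)
    case (Suc m)
    then show ?case using F(2)[of i m] by (cases "i = m") auto
  qed simp
  \<comment> \<open>Entry \<open>i\<close> is settled from stage \<open>Suc i\<close> on, so a
    condition on finitely many entries of \<open>f\<close> can be checked in a single late
    \<open>F m\<close>.\<close>
  define f where "f i = F (Suc i) i" for i
  have f: "F m i = f i" if "i < m" for m i using stable[OF that] by (simp add: f_def)
  show thesis
  proof
    show "bad P f"
    proof (intro allI impI)
      fix i j :: nat assume ij: "i < j"
      then have "\<not> P (F (Suc j) i) (F (Suc j) j)" using F(1)[of "Suc j"] unfolding Q_def by blast
      then show "\<not> P (f i) (f j)" using ij f[of i "Suc j"] f[of j "Suc j"] by simp
    qed
    fix k g assume "bad P g" "\<And>i. i < k \<Longrightarrow> g i = f i"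
    then show "size (f k) \<le> size (g k)"
      using F(1)[of "Suc k"] f[of _ "Suc k"] by (auto simp: Q_def)
  qed
qed

lemma ex_incseq_subseq_nat:
  fixes a :: "nat \<Rightarrow> nat"
  obtains \<phi> :: "nat \<Rightarrow> nat" where "strict_mono \<phi>" "\<And>i j. i \<le> j \<Longrightarrow> a (\<phi> i) \<le> a (\<phi> j)"
proof -
  obtain \<phi> where \<phi>: "strict_mono \<phi>" "monoseq (\<lambda>n. a (\<phi> n))" using seq_monosub by blast
  show thesis
  proof (cases "\<forall>m n. m \<le> n \<longrightarrow> a (\<phi> m) \<le> a (\<phi> n)")
    case True
    then show ?thesis using that \<phi>(1) by blast
  next
    case False
    then have dec: "\<And>m n. m \<le> n \<Longrightarrow> a (\<phi> n) \<le> a (\<phi> m)" using \<phi>(2) by (auto simp: monoseq_def)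
    \<comment> \<open>A decreasing sequence of naturals is constant from the place of its least
      value on, so shifting by \<open>m\<close> makes it weakly increasing.\<close>
    obtain m where m: "\<And>n. a (\<phi> m) \<le> a (\<phi> n)"
      using ex_has_least_nat[of "\<lambda>_. True" 0 "\<lambda>n. a (\<phi> n)"] by auto
    have const: "a (\<phi> (m + n)) = a (\<phi> m)" for n using dec[of m "m + n"] m[of "m + n"] by simp
    show ?thesis
      by (rule that[of "\<lambda>n. \<phi> (m + n)"]) (use \<phi>(1) const in \<open>auto simp: strict_mono_def\<close>)
  qed
qed

text \<open>Along a subsequence with weakly increasing first letters, these letters are deleted, and
  the minimal bad sequence is kept before \<open>k\<close>. The result is still bad but has a
  shorter word at \<open>k\<close>, against minimality.\<close>

theorem higman_nat:
  fixes f0 :: "nat \<Rightarrow> nat list"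
  shows "\<exists>i j. i < j \<and> list_emb (\<le>) (f0 i) (f0 j)"
proof (rule ccontr)
  let ?P = "list_emb (\<le>) :: nat list \<Rightarrow> nat list \<Rightarrow> bool"
  assume "\<not> (\<exists>i j. i < j \<and> ?P (f0 i) (f0 j))"
  then have "bad ?P f0" by blast
  then obtain f where f: "bad ?P f"
    and minimal: "\<And>k g. bad ?P g \<Longrightarrow> (\<And>i. i < k \<Longrightarrow> g i = f i) \<Longrightarrow> length (f k) \<le> length (g k)"
    using ex_minimal_bad_seq[of ?P f0 length] by blast
  have ne: "f i \<noteq> []" for i using f[rule_format, of i "Suc i"] by auto
  obtain \<phi> :: "nat \<Rightarrow> nat" where \<phi>: "strict_mono \<phi>" "\<And>i j. i \<le> j \<Longrightarrow> hd (f (\<phi> i)) \<le> hd (f (\<phi> j))"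
    using ex_incseq_subseq_nat[of "\<lambda>i. hd (f i)"] by blast
  define k where "k = \<phi> 0"
  define g where "g i = (if i < k then f i else tl (f (\<phi> (i - k))))" for i
  have tl_emb: "?P (tl (f i)) (f i)" for i
    using ne[of i] list_emb_Cons[OF list_emb_refl, of "tl (f i)" "(\<le>)" "hd (f i)"] by simp
  have "bad ?P g"
  proof (intro allI impI notI)
    fix i j :: nat assume ij: "i < j" and emb: "?P (g i) (g j)"
    consider "j < k" | "i < k" "k \<le> j" | "k \<le> i" using ij by linarith
    then show False
    proof cases
      case 1
      then show ?thesis using ij emb f by (auto simp: g_def)
    next
      case 2
      then have "?P (f i) (f (\<phi> (j - k)))"
        using emb tl_emb[of "\<phi> (j - k)"]
        by (auto simp: g_def intro: list_emb_trans[of "f i" "tl (f (\<phi> (j - k)))"])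
      moreover have "i < \<phi> (j - k)"
        using 2 \<phi>(1) by (metis k_def le0 less_le_trans strict_mono_less_eq)
      ultimately show ?thesis using f by blast
    next
      case 3
      let ?i = "\<phi> (i - k)" and ?j = "\<phi> (j - k)"
      have "?P (tl (f ?i)) (tl (f ?j))" using 3 ij emb by (simp add: g_def)
      moreover have "hd (f ?i) \<le> hd (f ?j)" using 3 ij \<phi>(2) by simp
      ultimately have "?P (hd (f ?i) # tl (f ?i)) (hd (f ?j) # tl (f ?j))" by blast
      then have "?P (f ?i) (f ?j)" using ne by simp
      moreover have "?i < ?j" using \<phi>(1) 3 ij by (simp add: strict_mono_def)
      ultimately show ?thesis using f by blast
    qed
  qed
  then have "length (f k) \<le> length (g k)" by (rule minimal) (simp add: g_def)
  then show False using ne[of k] by (cases "f k") (simp_all add: g_def k_def)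
qed

text \<open>The index map of an embedding is made total and strictly increasing on all naturals, so
  that it can act on every indeterminate.\<close>

lemma list_emb_strict_mono_index:
  assumes "list_emb P xs ys"
  obtains \<pi> :: "nat \<Rightarrow> nat" where "strict_mono \<pi>"
    "\<And>i. i < length xs \<Longrightarrow> \<pi> i < length ys \<and> P (xs ! i) (ys ! \<pi> i)"
  using assms
proof (induction arbitrary: thesis)
  case (list_emb_Nil ys)
  show ?case by (rule list_emb_Nil[of id]) (auto simp: strict_mono_def)
next
  case (list_emb_Cons xs ys y)
  obtain \<pi> where "strict_mono \<pi>"
    "\<And>i. i < length xs \<Longrightarrow> \<pi> i < length ys \<and> P (xs ! i) (ys ! \<pi> i)" using list_emb_Cons.IH by blast
  then show ?case by (intro list_emb_Cons.prems[of "Suc \<circ> \<pi>"]) (auto simp: strict_mono_def)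
next
  case (list_emb_Cons2 x y xs ys)
  obtain \<pi> where \<pi>: "strict_mono \<pi>"
    "\<And>i. i < length xs \<Longrightarrow> \<pi> i < length ys \<and> P (xs ! i) (ys ! \<pi> i)" using list_emb_Cons2.IH by blast
  show ?case
    by (rule list_emb_Cons2.prems[of "case_nat 0 (Suc \<circ> \<pi>)"])
      (use \<pi> list_emb_Cons2.hyps in \<open>auto simp: strict_mono_def less_Suc_eq_0_disj split: nat.splits\<close>)
qed


section \<open>Maps of indeterminates\<close>

lemma poly_mapping_sum_singles:
  assumes "finite S" "Poly_Mapping.keys f \<subseteq> S"
  shows "f = (\<Sum>t\<in>S. Poly_Mapping.single t (Poly_Mapping.lookup f t))"
  by (rule poly_mapping_eqI)
    (use assms in \<open>auto simp: lookup_sum lookup_single when_def sum.delta in_keys_iff subset_iff\<close>)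

lemma lookup_single_mult:
  fixes f :: "('a::cancel_comm_monoid_add) \<Rightarrow>\<^sub>0 ('k::comm_semiring_1)"
  shows "Poly_Mapping.lookup (Poly_Mapping.single w c * f) (w + t) = c * Poly_Mapping.lookup f t"
proof -
  let ?K = "Poly_Mapping.keys f"
  have "Poly_Mapping.single w c * f =
      Poly_Mapping.single w c * (\<Sum>s\<in>?K. Poly_Mapping.single s (Poly_Mapping.lookup f s))"
    using poly_mapping_sum_singles[of ?K f] by simp
  also have "\<dots> = (\<Sum>s\<in>?K. Poly_Mapping.single (w + s) (c * Poly_Mapping.lookup f s))"
    by (simp add: sum_distrib_left mult_single)
  finally show ?thesis
    by (auto simp: lookup_sum lookup_single when_def in_keys_iff)
qed

lemma keys_single_mult:
  fixes f :: "('a::cancel_comm_monoid_add) \<Rightarrow>\<^sub>0 ('k::comm_semiring_1)"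
  shows "Poly_Mapping.keys (Poly_Mapping.single w c * f) \<subseteq> (+) w ` Poly_Mapping.keys f"
proof -
  have "Poly_Mapping.keys (Poly_Mapping.single w c * f)
      \<subseteq> {a + b |a b. a \<in> Poly_Mapping.keys (Poly_Mapping.single w c) \<and> b \<in> Poly_Mapping.keys f}"
    by (rule keys_mult)
  also have "\<dots> \<subseteq> (+) w ` Poly_Mapping.keys f" by (auto split: if_splits)
  finally show ?thesis .
qed

lemma perm_mon_superset:
  assumes "finite S" "Poly_Mapping.keys t \<subseteq> S"
  shows "perm_mon \<sigma> t = (\<Sum>i\<in>S. Poly_Mapping.single (\<sigma> i) (Poly_Mapping.lookup t i))"
  unfolding perm_mon_def by (rule sum.mono_neutral_left) (use assms in \<open>auto simp: in_keys_iff\<close>)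

lemma perm_mon_zero [simp]: "perm_mon \<sigma> 0 = 0"
  by (simp add: perm_mon_def)

lemma perm_mon_add: "perm_mon \<sigma> (s + t) = perm_mon \<sigma> s + perm_mon \<sigma> t"
proof -
  let ?S = "Poly_Mapping.keys s \<union> Poly_Mapping.keys t"
  have "Poly_Mapping.keys (s + t) \<subseteq> ?S" by (rule keys_add)
  then show ?thesis
    by (simp add: perm_mon_superset[of ?S] lookup_add single_add sum.distrib)
qed

lemma perm_mon_single [simp]:
  "perm_mon \<sigma> (Poly_Mapping.single i n) = Poly_Mapping.single (\<sigma> i) n"
  by (simp add: perm_mon_superset[of "{i}"])

lemma perm_mon_cong:
  "(\<And>i. i \<in> Poly_Mapping.keys t \<Longrightarrow> \<sigma> i = \<tau> i) \<Longrightarrow> perm_mon \<sigma> t = perm_mon \<tau> t"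
  by (simp add: perm_mon_def)

lemma perm_mon_perm_mon: "perm_mon \<sigma> (perm_mon \<tau> t) = perm_mon (\<sigma> \<circ> \<tau>) t"
proof -
  have "perm_mon \<sigma> (sum f S) = (\<Sum>i\<in>S. perm_mon \<sigma> (f i))" for f :: "nat \<Rightarrow> mon" and S
    by (induction S rule: infinite_finite_induct) (simp_all add: perm_mon_add)
  then have "perm_mon \<sigma> (perm_mon \<tau> t) = (\<Sum>i\<in>Poly_Mapping.keys t.
      perm_mon \<sigma> (Poly_Mapping.single (\<tau> i) (Poly_Mapping.lookup t i)))"
    by (simp only: perm_mon_def[of \<tau>])
  then show ?thesis by (simp only: perm_mon_single) (simp add: perm_mon_def)
qed

lemma lookup_perm_mon:
  "Poly_Mapping.lookup (perm_mon \<sigma> t) j =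
     (\<Sum>i\<in>Poly_Mapping.keys t. if \<sigma> i = j then Poly_Mapping.lookup t i else 0)"
  by (simp add: perm_mon_def lookup_sum lookup_single when_def)

lemma lookup_perm_mon_inj:
  assumes "inj \<sigma>"
  shows "Poly_Mapping.lookup (perm_mon \<sigma> t) (\<sigma> i) = Poly_Mapping.lookup t i"
  using assms by (auto simp: lookup_perm_mon inj_eq in_keys_iff)

lemma lookup_perm_mon_notin_range:
  "j \<notin> range \<sigma> \<Longrightarrow> Poly_Mapping.lookup (perm_mon \<sigma> t) j = 0"
  by (auto simp: lookup_perm_mon intro!: sum.neutral)

lemma keys_perm_mon: "Poly_Mapping.keys (perm_mon \<sigma> t) \<subseteq> \<sigma> ` Poly_Mapping.keys t"
proof
  fix j assume "j \<in> Poly_Mapping.keys (perm_mon \<sigma> t)"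
  then have "(\<Sum>i\<in>Poly_Mapping.keys t. if \<sigma> i = j then Poly_Mapping.lookup t i else 0) \<noteq> 0"
    unfolding in_keys_iff lookup_perm_mon .
  then show "j \<in> \<sigma> ` Poly_Mapping.keys t"
    by (rule sum.not_neutral_contains_not_neutral) (auto split: if_splits)
qed

lemma inj_perm_mon: "inj \<sigma> \<Longrightarrow> inj (perm_mon \<sigma>)"
  by (rule injI, rule poly_mapping_eqI) (metis lookup_perm_mon_inj)

lemma perm_poly_superset:
  fixes f :: "'k::comm_ring_1 rpoly"
  assumes "finite S" "Poly_Mapping.keys f \<subseteq> S"
  shows "perm_poly \<sigma> f = (\<Sum>t\<in>S. Poly_Mapping.single (perm_mon \<sigma> t) (Poly_Mapping.lookup f t))"
  unfolding perm_poly_def by (rule sum.mono_neutral_left) (use assms in \<open>auto simp: in_keys_iff\<close>)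

lemma perm_poly_zero [simp]: "perm_poly \<sigma> 0 = 0"
  by (simp add: perm_poly_def)

lemma perm_poly_add: "perm_poly \<sigma> (f + g) = perm_poly \<sigma> f + perm_poly \<sigma> g"
proof -
  let ?S = "Poly_Mapping.keys f \<union> Poly_Mapping.keys g"
  have "Poly_Mapping.keys (f + g) \<subseteq> ?S" by (rule keys_add)
  then show ?thesis
    by (simp add: perm_poly_superset[of ?S] lookup_add single_add sum.distrib)
qed

lemma perm_poly_single [simp]:
  "perm_poly \<sigma> (Poly_Mapping.single t c) = Poly_Mapping.single (perm_mon \<sigma> t) c"
  by (simp add: perm_poly_superset[of "{t}"])

lemma perm_poly_sum: "perm_poly \<sigma> (sum f S) = (\<Sum>i\<in>S. perm_poly \<sigma> (f i))"
  by (induction S rule: infinite_finite_induct) (simp_all add: perm_poly_add)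

lemma perm_poly_mult: "perm_poly \<sigma> (f * g) = perm_poly \<sigma> f * perm_poly \<sigma> g"
proof -
  let ?s = "\<lambda>f t. Poly_Mapping.single t (Poly_Mapping.lookup f t)"
  have f: "f = (\<Sum>t\<in>Poly_Mapping.keys f. ?s f t)" and g: "g = (\<Sum>t\<in>Poly_Mapping.keys g. ?s g t)"
    by (simp_all add: poly_mapping_sum_singles)
  have "f * g = (\<Sum>t\<in>Poly_Mapping.keys f. ?s f t) * (\<Sum>t\<in>Poly_Mapping.keys g. ?s g t)"
    using f g by simp
  then have "perm_poly \<sigma> (f * g) =
      perm_poly \<sigma> (\<Sum>t\<in>Poly_Mapping.keys f. \<Sum>s\<in>Poly_Mapping.keys g. ?s f t * ?s g s)"
    by (simp add: sum_product)
  also have "\<dots> = perm_poly \<sigma> f * perm_poly \<sigma> g"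
    by (simp add: perm_poly_sum mult_single perm_mon_add)
      (simp add: perm_poly_def sum_product mult_single)
  finally show ?thesis .
qed

lemma perm_poly_uminus: "perm_poly \<sigma> (- f) = - perm_poly \<sigma> f"
  using perm_poly_add[of \<sigma> f "- f"] by (simp add: eq_neg_iff_add_eq_0 add.commute)

lemma perm_poly_diff: "perm_poly \<sigma> (f - g) = perm_poly \<sigma> f - perm_poly \<sigma> g"
  using perm_poly_add[of \<sigma> f "- g"] by (simp add: perm_poly_uminus)

lemma perm_poly_cong:
  "(\<And>t i. t \<in> Poly_Mapping.keys f \<Longrightarrow> i \<in> Poly_Mapping.keys t \<Longrightarrow> \<sigma> i = \<tau> i) \<Longrightarrow>
    perm_poly \<sigma> f = perm_poly \<tau> f"
  unfolding perm_poly_def by (intro sum.cong refl arg_cong2[where f = Poly_Mapping.single] perm_mon_cong)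

lemma perm_poly_perm_poly: "perm_poly \<sigma> (perm_poly \<tau> f) = perm_poly (\<sigma> \<circ> \<tau>) f"
proof -
  have "perm_poly \<sigma> (perm_poly \<tau> f) = (\<Sum>t\<in>Poly_Mapping.keys f.
      perm_poly \<sigma> (Poly_Mapping.single (perm_mon \<tau> t) (Poly_Mapping.lookup f t)))"
    by (simp only: perm_poly_def[of \<tau>] perm_poly_sum)
  then show ?thesis by (simp only: perm_poly_single) (simp add: perm_poly_def perm_mon_perm_mon)
qed

lemma perm_mon_id [simp]: "perm_mon id t = t"
  by (simp add: perm_mon_def flip: poly_mapping_sum_singles)

lemma perm_poly_id [simp]: "perm_poly id f = f"
  by (simp add: perm_poly_def flip: poly_mapping_sum_singles)

lemma lookup_perm_poly_inj:
  assumes "inj \<sigma>"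
  shows "Poly_Mapping.lookup (perm_poly \<sigma> f) (perm_mon \<sigma> t) = Poly_Mapping.lookup f t"
  using inj_perm_mon[OF assms]
  by (auto simp: perm_poly_def lookup_sum lookup_single when_def inj_eq in_keys_iff)

lemma keys_perm_poly: "Poly_Mapping.keys (perm_poly \<sigma> f) \<subseteq> perm_mon \<sigma> ` Poly_Mapping.keys f"
proof
  fix u assume "u \<in> Poly_Mapping.keys (perm_poly \<sigma> f)"
  then have "(\<Sum>t\<in>Poly_Mapping.keys f. if perm_mon \<sigma> t = u then Poly_Mapping.lookup f t else 0) \<noteq> 0"
    by (simp add: in_keys_iff perm_poly_def lookup_sum lookup_single when_def)
  then show "u \<in> perm_mon \<sigma> ` Poly_Mapping.keys f"
    by (rule sum.not_neutral_contains_not_neutral) (auto split: if_splits)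
qed

lemma perm_poly_eq_0_iff: "inj \<sigma> \<Longrightarrow> perm_poly \<sigma> f = 0 \<longleftrightarrow> f = 0"
  using lookup_perm_poly_inj[of \<sigma> f] by (metis lookup_zero perm_poly_zero poly_mapping_eqI)


section \<open>The monomial order\<close>

lemma mon_less_irrefl: "\<not> mon_less t t"
  by (simp add: mon_less_def)

lemma mon_less_trans: "mon_less s t \<Longrightarrow> mon_less t u \<Longrightarrow> mon_less s u"
proof -
  assume "mon_less s t" "mon_less t u"
  then obtain i j where i: "Poly_Mapping.lookup s i < Poly_Mapping.lookup t i"
      "\<And>k. k > i \<Longrightarrow> Poly_Mapping.lookup s k = Poly_Mapping.lookup t k"
    and j: "Poly_Mapping.lookup t j < Poly_Mapping.lookup u j"
      "\<And>k. k > j \<Longrightarrow> Poly_Mapping.lookup t k = Poly_Mapping.lookup u k"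
    by (auto simp: mon_less_def)
  show ?thesis
    unfolding mon_less_def
    by (rule exI[of _ "max i j"]) (use i j in \<open>cases i j rule: linorder_cases; auto simp: max_def\<close>)
qed

lemma mon_less_linear:
  assumes "s \<noteq> t" shows "mon_less s t \<or> mon_less t s"
proof -
  let ?D = "{i. Poly_Mapping.lookup s i \<noteq> Poly_Mapping.lookup t i}"
  have "?D \<subseteq> Poly_Mapping.keys s \<union> Poly_Mapping.keys t" by (auto simp: in_keys_iff)
  then have fin: "finite ?D" by (rule finite_subset) simp
  have "\<exists>i. Poly_Mapping.lookup s i \<noteq> Poly_Mapping.lookup t i"
    using assms poly_mapping_eqI[of s t] by metis
  then have "?D \<noteq> {}" by blast
  define m where "m = Max ?D"
  have "m \<in> ?D" unfolding m_def using fin \<open>?D \<noteq> {}\<close> by (rule Max_in)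
  moreover have "\<forall>j>m. Poly_Mapping.lookup s j = Poly_Mapping.lookup t j"
    using Max_ge[OF fin] unfolding m_def by fastforce
  moreover from this have "\<forall>j>m. Poly_Mapping.lookup t j = Poly_Mapping.lookup s j" by simp
  ultimately show ?thesis
    unfolding mon_less_def by (cases "Poly_Mapping.lookup s m" "Poly_Mapping.lookup t m" rule: linorder_cases)
      blast+
qed

global_interpretation mon: linorder mon_le mon_less
proof
  fix s t u :: mon
  show "mon_less s t \<longleftrightarrow> mon_le s t \<and> \<not> mon_le t s"
    by (auto simp: mon_le_def mon_less_irrefl dest: mon_less_trans)
  show "mon_le s s" by (simp add: mon_le_def)
  show "mon_le s t \<Longrightarrow> mon_le t u \<Longrightarrow> mon_le s u"
    by (auto simp: mon_le_def dest: mon_less_trans)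
  show "mon_le s t \<Longrightarrow> mon_le t s \<Longrightarrow> s = t"
    by (metis mon_le_def mon_less_irrefl mon_less_trans)
  show "mon_le s t \<or> mon_le t s" using mon_less_linear[of s t] by (auto simp: mon_le_def)
qed

lemma mon_less_add: "mon_less s t \<Longrightarrow> mon_less (u + s) (u + t)"
  by (auto simp: mon_less_def lookup_add)

lemma mon_le_add: "mon_le s t \<Longrightarrow> mon_le (u + s) (u + t)"
  by (auto simp: mon_le_def mon_less_add)

lemma mon_le_zero: "mon_le 0 t"
proof -
  have "\<not> mon_less t 0" by (simp add: mon_less_def)
  then show ?thesis by simp
qed

lemma mon_le_add_self: "mon_le t (u + t)"
  using mon_le_add[OF mon_le_zero, of t u] by (simp add: add.commute)

text \<open>The largest index \<open>i\<close> where the exponents differ moves to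
  \<open>\<pi> i\<close>. Above it, indices in the range of \<open>\<pi>\<close> come from indices
  above \<open>i\<close>, and the others carry exponent 0 on both sides.\<close>

lemma mon_less_perm_mon:
  assumes "strict_mono \<pi>" "mon_less s t" shows "mon_less (perm_mon \<pi> s) (perm_mon \<pi> t)"
proof -
  have inj: "inj \<pi>" using assms(1) by (rule strict_mono_imp_inj_on)
  obtain i where i: "Poly_Mapping.lookup s i < Poly_Mapping.lookup t i"
      "\<And>k. k > i \<Longrightarrow> Poly_Mapping.lookup s k = Poly_Mapping.lookup t k"
    using assms(2) by (auto simp: mon_less_def)
  have "Poly_Mapping.lookup (perm_mon \<pi> s) j = Poly_Mapping.lookup (perm_mon \<pi> t) j"
    if "j > \<pi> i" for j
  proof (cases "j \<in> range \<pi>")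
    case True
    then show ?thesis
      using that i(2) assms(1) by (auto simp: lookup_perm_mon_inj[OF inj] strict_mono_less)
  qed (simp add: lookup_perm_mon_notin_range)
  then show ?thesis
    unfolding mon_less_def using i(1) by (intro exI[of _ "\<pi> i"]) (simp add: lookup_perm_mon_inj[OF inj])
qed

lemma mon_le_perm_mon:
  "strict_mono \<pi> \<Longrightarrow> mon_le s t \<Longrightarrow> mon_le (perm_mon \<pi> s) (perm_mon \<pi> t)"
  by (auto simp: mon_le_def mon_less_perm_mon)

text \<open>Let \<open>n\<close> be the largest index in \<open>t\<close>. If \<open>\<pi>\<close>
  fixes \<open>n\<close>, it fixes everything below and \<open>t\<close> is unchanged; otherwise
  \<open>n\<close> moves to a larger index that does not occur in \<open>t\<close>. This supplies
  the clause \<open>mon_le v w\<close> of a witness.\<close>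

lemma mon_le_perm_mon_self:
  assumes "strict_mono \<pi>" shows "mon_le t (perm_mon \<pi> t)"
proof (cases "t = 0")
  case True
  then show ?thesis by simp
next
  case False
  let ?K = "Poly_Mapping.keys t"
  define n where "n = Max ?K"
  have "?K \<noteq> {}" using False by simp
  then have n: "n \<in> ?K" "\<And>i. i \<in> ?K \<Longrightarrow> i \<le> n" by (simp_all add: n_def)
  have inj: "inj \<pi>" using assms by (rule strict_mono_imp_inj_on)
  have ge: "i \<le> \<pi> i" for i using assms by (rule strict_mono_imp_increasing)
  show ?thesis
  proof (cases "\<pi> n = n")
    case True
    have "\<pi> i = i" if "i \<le> n" for i
      using that
    proof (induction rule: inc_induct)
      case (step m)
      then show ?case using ge[of m] strict_monoD[OF assms, of m "Suc m"] by simp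
    qed (rule True)
    then have "perm_mon \<pi> t = perm_mon id t" by (intro perm_mon_cong) (simp add: n(2))
    then show ?thesis by simp
  next
    case False
    then have gt: "n < \<pi> n" using ge[of n] by simp
    have "Poly_Mapping.lookup t j = Poly_Mapping.lookup (perm_mon \<pi> t) j" if j: "j > \<pi> n" for j
    proof -
      have "j \<notin> ?K" using n(2)[of j] j gt by auto
      moreover have "j \<notin> \<pi> ` ?K"
      proof
        assume "j \<in> \<pi> ` ?K"
        then obtain i where "i \<in> ?K" "j = \<pi> i" by blast
        then show False using n(2)[of i] j strict_mono_less_eq[OF assms, of i n] by simp
      qed
      then have "j \<notin> Poly_Mapping.keys (perm_mon \<pi> t)" using keys_perm_mon by blast
      ultimately show ?thesis by (simp add: in_keys_iff)
    qed
    moreover have "Poly_Mapping.lookup t (\<pi> n) < Poly_Mapping.lookup (perm_mon \<pi> t) (\<pi> n)"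
    proof -
      have "\<pi> n \<notin> ?K" using n(2)[of "\<pi> n"] gt by auto
      then show ?thesis using n(1) by (simp add: lookup_perm_mon_inj[OF inj] in_keys_iff)
    qed
    ultimately show ?thesis by (auto simp: mon_le_def mon_less_def)
  qed
qed

text \<open>The order is decided at the largest differing index, so a smaller monomial cannot
  involve a larger indeterminate. Hence two maps that agree below \<open>n\<close> act alike on
  everything below \<open>t\<close>.\<close>

lemma mon_keys_below_mono:
  assumes "mon_le s t" "Poly_Mapping.keys t \<subseteq> {..<n}" shows "Poly_Mapping.keys s \<subseteq> {..<n}"
proof (cases "s = t")
  case False
  then obtain i where i: "Poly_Mapping.lookup s i < Poly_Mapping.lookup t i"
      "\<And>k. k > i \<Longrightarrow> Poly_Mapping.lookup s k = Poly_Mapping.lookup t k"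
    using assms(1) by (auto simp: mon_le_def mon_less_def)
  have "i < n" using i(1) assms(2) by (metis gr_implies_not0 in_keys_iff lessThan_iff subset_iff)
  show ?thesis
  proof
    fix k assume k: "k \<in> Poly_Mapping.keys s"
    show "k \<in> {..<n}"
    proof (cases "k > i")
      case True
      then have "k \<in> Poly_Mapping.keys t" using i(2) k by (simp add: in_keys_iff)
      then show ?thesis using assms(2) by blast
    qed (use \<open>i < n\<close> in simp)
  qed
qed (use assms in simp)

lemma ex_keys_below: "\<exists>n. Poly_Mapping.keys (t :: mon) \<subseteq> {..<n}"
  using finite_nat_bounded[of "Poly_Mapping.keys t"] by simp

lemma mon_dvd_iff: "mon_dvd s t \<longleftrightarrow> (\<forall>i. Poly_Mapping.lookup s i \<le> Poly_Mapping.lookup t i)"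
proof
  assume "\<forall>i. Poly_Mapping.lookup s i \<le> Poly_Mapping.lookup t i"
  then have "t = (t - s) + s" by (intro poly_mapping_eqI) (simp add: lookup_add lookup_minus)
  then show "mon_dvd s t" unfolding mon_dvd_def by blast
qed (auto simp: mon_dvd_def lookup_add)

text \<open>A monomial is read as its word of exponents. The last conclusion says that every index
  up to one occurring in \<open>m i\<close> is sent into any range containing the indeterminates of
  \<open>m j\<close>; the termination proof of the completion rests on it.\<close>

lemma higman_mon:
  fixes m :: "nat \<Rightarrow> mon"
  obtains i j \<pi> where "i < j" "strict_mono \<pi>" "mon_dvd (perm_mon \<pi> (m i)) (m j)"
    "\<forall>n. Poly_Mapping.keys (m j) \<subseteq> {..<n} \<longrightarrow> (\<forall>k\<in>Poly_Mapping.keys (m i). \<forall>l\<le>k. \<pi> l < n)"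
proof -
  \<comment> \<open>The words have least possible length: the embedding bounds \<open>\<pi>\<close>
    by the length of the second word, and minimality bounds that length by every admissible
    \<open>n\<close>.\<close>
  define d where "d k = (LEAST n. Poly_Mapping.keys (m k) \<subseteq> {..<n})" for k
  have d: "Poly_Mapping.keys (m k) \<subseteq> {..<d k}" for k
    unfolding d_def using ex_keys_below by (rule LeastI_ex)
  define e where "e k = map (Poly_Mapping.lookup (m k)) [0..<d k]" for k
  obtain i j where ij: "i < j" "list_emb (\<le>) (e i) (e j)" using higman_nat by blast
  obtain \<pi> where \<pi>: "strict_mono \<pi>"
    "\<And>l. l < length (e i) \<Longrightarrow> \<pi> l < length (e j) \<and> e i ! l \<le> e j ! \<pi> l"
    using list_emb_strict_mono_index[OF ij(2)] by blast
  have inj: "inj \<pi>" using \<pi>(1) by (rule strict_mono_imp_inj_on)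
  have dvd: "mon_dvd (perm_mon \<pi> (m i)) (m j)"
    unfolding mon_dvd_iff
  proof
    fix l
    show "Poly_Mapping.lookup (perm_mon \<pi> (m i)) l \<le> Poly_Mapping.lookup (m j) l"
    proof (cases "l \<in> \<pi> ` Poly_Mapping.keys (m i)")
      case True
      then obtain k where k: "l = \<pi> k" "k \<in> Poly_Mapping.keys (m i)" by blast
      then have "k < d i" using d by blast
      then show ?thesis using \<pi>(2)[of k] k by (auto simp: e_def lookup_perm_mon_inj[OF inj])
    next
      case False
      then have "l \<notin> Poly_Mapping.keys (perm_mon \<pi> (m i))" using keys_perm_mon by blast
      then show ?thesis by (simp add: in_keys_iff)
    qed
  qed
  show thesis
  proof (rule that[OF ij(1) \<pi>(1) dvd], intro allI impI ballI)
    fix n k l assume n: "Poly_Mapping.keys (m j) \<subseteq> {..<n}" and "k \<in> Poly_Mapping.keys (m i)" "l \<le> k"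
    then have "l < d i" using d[of i] by auto
    moreover have "d j \<le> n" unfolding d_def using n by (rule Least_le)
    ultimately show "\<pi> l < n" using \<pi>(2)[of l] by (simp add: e_def)
  qed
qed

text \<open>In an infinite descent, Higman's lemma yields \<open>i < j\<close> such that a strictly
  increasing image of \<open>m i\<close> divides \<open>m j\<close>; passing to the image and to a
  multiple never decreases a monomial, so \<open>m i\<close> is at most \<open>m j\<close>.\<close>

lemma wf_mon_less: "wfP mon_less"
  unfolding wfp_def
proof (rule ccontr)
  assume "\<not> wf {(x, y). mon_less x y}"
  then obtain m where m: "\<And>i. mon_less (m (Suc i)) (m i)" by (auto simp: wf_iff_no_infinite_down_chain)
  obtain i j \<pi> where ij: "i < j" "strict_mono \<pi>" "mon_dvd (perm_mon \<pi> (m i)) (m j)"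
    by (rule higman_mon[of m])
  have "mon_less (m j) (m i)"
    using ij(1) by (induction j) (use m in \<open>auto simp: less_Suc_eq dest: mon_less_trans\<close>)
  moreover have "mon_le (m i) (m j)"
    using ij(3) mon.order_trans[OF mon_le_perm_mon_self[OF ij(2), of "m i"] mon_le_add_self]
    by (auto simp: mon_dvd_def)
  ultimately show False by simp
qed

section \<open>Leading monomials and S-polynomials\<close>

abbreviation lc :: "'k::field rpoly \<Rightarrow> 'k" where
  "lc f \<equiv> Poly_Mapping.lookup f (lm f)"

lemma lm_eqI:
  assumes "t \<in> Poly_Mapping.keys f" "\<And>u. u \<in> Poly_Mapping.keys f \<Longrightarrow> mon_le u t"
  shows "lm f = t"
  unfolding lm_def using assms by (intro the_equality) (auto intro: mon.order_antisym)

lemma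
  assumes "f \<noteq> 0"
  shows lm_in_keys: "lm f \<in> Poly_Mapping.keys f"
    and lm_ge: "u \<in> Poly_Mapping.keys f \<Longrightarrow> mon_le u (lm f)"
proof -
  have fin: "finite (Poly_Mapping.keys f)" "Poly_Mapping.keys f \<noteq> {}" using assms by simp_all
  have "lm f = mon.Max (Poly_Mapping.keys f)"
    using mon.Max_in[OF fin] mon.Max_ge[OF fin(1)] by (rule lm_eqI)
  then show "lm f \<in> Poly_Mapping.keys f" "u \<in> Poly_Mapping.keys f \<Longrightarrow> mon_le u (lm f)"
    using mon.Max_in[OF fin] mon.Max_ge[OF fin(1)] by simp_all
qed

lemma lc_neq_0: "f \<noteq> 0 \<Longrightarrow> lc f \<noteq> 0"
  using lm_in_keys by (simp add: in_keys_iff)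

lemma lookup_eq_0_above_lm: "mon_less (lm f) u \<Longrightarrow> Poly_Mapping.lookup f u = 0"
  by (metis in_keys_iff lm_ge lookup_zero mon.leD)

lemma lm_single_mult:
  assumes "c \<noteq> 0" "f \<noteq> 0" shows "lm (Poly_Mapping.single w c * f) = w + lm f"
proof (rule lm_eqI)
  show "w + lm f \<in> Poly_Mapping.keys (Poly_Mapping.single w c * f)"
    using assms lc_neq_0 by (simp add: in_keys_iff lookup_single_mult)
  fix u assume "u \<in> Poly_Mapping.keys (Poly_Mapping.single w c * f)"
  then show "mon_le u (w + lm f)"
    using keys_single_mult[of w c f] lm_ge[OF assms(2)] mon_le_add by blast
qed

text \<open>An injection that reorders indices can make another monomial the leading one. Therefore
  images are factored into a bounded injection followed by a strictly increasing map.\<close>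

lemma lm_perm_poly:
  assumes "strict_mono \<pi>" "f \<noteq> 0" shows "lm (perm_poly \<pi> f) = perm_mon \<pi> (lm f)"
proof (rule lm_eqI)
  have "inj \<pi>" using assms(1) by (rule strict_mono_imp_inj_on)
  then show "perm_mon \<pi> (lm f) \<in> Poly_Mapping.keys (perm_poly \<pi> f)"
    using assms(2) lc_neq_0 by (simp add: in_keys_iff lookup_perm_poly_inj)
  fix u assume "u \<in> Poly_Mapping.keys (perm_poly \<pi> f)"
  then show "mon_le u (perm_mon \<pi> (lm f))"
    using keys_perm_poly[of \<pi> f] lm_ge[OF assms(2)] mon_le_perm_mon[OF assms(1)] by blast
qed

text \<open>Subtraction of exponents is truncated, so \<open>t - s\<close> is the least \<open>u\<close> such that \<open>t\<close> divides \<open>u + s\<close>.\<close>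

definition mon_lcm :: "mon \<Rightarrow> mon \<Rightarrow> mon" where
  "mon_lcm s t = (t - s) + s"

lemma mon_lcm_commute: "mon_lcm s t = mon_lcm t s"
  by (rule poly_mapping_eqI) (simp add: mon_lcm_def lookup_add lookup_minus)

lemma mon_lcm_absorb: "mon_dvd t s \<Longrightarrow> mon_lcm s t = s"
  by (rule poly_mapping_eqI) (simp add: mon_lcm_def lookup_add lookup_minus mon_dvd_iff)

lemma perm_mon_minus:
  assumes "inj \<sigma>" shows "perm_mon \<sigma> (s - t) = perm_mon \<sigma> s - perm_mon \<sigma> t"
proof (rule poly_mapping_eqI)
  fix j
  show "Poly_Mapping.lookup (perm_mon \<sigma> (s - t)) j = Poly_Mapping.lookup (perm_mon \<sigma> s - perm_mon \<sigma> t) j"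
    by (cases "j \<in> range \<sigma>")
      (auto simp: lookup_minus lookup_perm_mon_inj[OF assms] lookup_perm_mon_notin_range)
qed

lemma perm_mon_lcm: "inj \<sigma> \<Longrightarrow> perm_mon \<sigma> (mon_lcm s t) = mon_lcm (perm_mon \<sigma> s) (perm_mon \<sigma> t)"
  by (simp add: mon_lcm_def perm_mon_add perm_mon_minus)

text \<open>Cross-multiplying by leading coefficients avoids division. If \<open>lm h\<close>
  divides \<open>lm f\<close>, then \<open>lm h - lm f\<close> is 0 and the result is a nonzero
  multiple of an ordinary division step of \<open>f\<close> by \<open>h\<close>.\<close>

definition spoly :: "'k::field rpoly \<Rightarrow> 'k rpoly \<Rightarrow> 'k rpoly" where
  "spoly f h = Poly_Mapping.single (lm h - lm f) (lc h) * f - Poly_Mapping.single (lm f - lm h) (lc f) * h"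

lemma perm_spoly:
  assumes "strict_mono \<pi>" "f \<noteq> 0" "h \<noteq> 0"
  shows "perm_poly \<pi> (spoly f h) = spoly (perm_poly \<pi> f) (perm_poly \<pi> h)"
proof -
  have "inj \<pi>" using assms(1) by (rule strict_mono_imp_inj_on)
  then show ?thesis
    using assms by (simp add: spoly_def perm_poly_diff perm_poly_mult lm_perm_poly perm_mon_minus
        lookup_perm_poly_inj)
qed

text \<open>Both products have leading monomial \<open>mon_lcm (lm f) (lm h)\<close> with the same
  coefficient \<open>lc f * lc h\<close>, so the top cancels.\<close>

lemma keys_spoly:
  assumes "f \<noteq> 0" "h \<noteq> 0" "u \<in> Poly_Mapping.keys (spoly f h)"
  shows "mon_less u (mon_lcm (lm f) (lm h))"
proof -
  let ?L = "mon_lcm (lm f) (lm h)"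
  let ?f = "Poly_Mapping.single (lm h - lm f) (lc h) * f"
  let ?h = "Poly_Mapping.single (lm f - lm h) (lc f) * h"
  have "lm ?f = ?L"
    unfolding mon_lcm_def by (rule lm_single_mult[OF lc_neq_0[OF assms(2)] assms(1)])
  moreover have "lm ?h = ?L"
    by (subst mon_lcm_commute) (simp add: mon_lcm_def lm_single_mult lc_neq_0 assms)
  moreover have "Poly_Mapping.lookup ?f ?L = lc h * lc f"
    by (simp add: mon_lcm_def lookup_single_mult)
  moreover have "Poly_Mapping.lookup ?h ?L = lc f * lc h"
    by (subst mon_lcm_commute) (simp add: mon_lcm_def lookup_single_mult)
  ultimately have "Poly_Mapping.lookup (spoly f h) v = 0" if "\<not> mon_less v ?L" for v
    using that lookup_eq_0_above_lm[of ?f v] lookup_eq_0_above_lm[of ?h v]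
    by (cases "v = ?L") (auto simp: spoly_def lookup_minus)
  then show ?thesis using assms(3) by (auto simp: in_keys_iff)
qed

lemma lm_spoly_less:
  assumes "f \<noteq> 0" "h \<noteq> 0" "mon_dvd (lm h) (lm f)" "spoly f h \<noteq> 0"
  shows "mon_less (lm (spoly f h)) (lm f)"
  using keys_spoly[OF assms(1,2) lm_in_keys[OF assms(4)]] assms(3) by (simp add: mon_lcm_absorb)


section \<open>Buchberger's criterion for infinite sets of generators\<close>

text \<open>With \<open>R\<close> bounding monomials by \<open>t\<close> this is a t-representation:
  every summand has leading monomial within the bound, although cancellation may push
  \<open>lm f\<close> lower. With \<open>R\<close> constantly true it expresses membership in the
  ideal generated by \<open>B\<close>.\<close>

inductive rep :: "'k::field rpoly set \<Rightarrow> (mon \<Rightarrow> bool) \<Rightarrow> 'k rpoly \<Rightarrow> bool" for B R where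
  rep_zero: "rep B R 0"
| rep_step: "rep B R f \<Longrightarrow> b \<in> B \<Longrightarrow> R (w + lm b) \<Longrightarrow> rep B R (f + Poly_Mapping.single w c * b)"

lemma rep_generator: "b \<in> B \<Longrightarrow> R (w + lm b) \<Longrightarrow> rep B R (Poly_Mapping.single w c * b)"
  using rep_step[OF rep_zero, of b B R w c] by simp

lemma rep_add: "rep B R g \<Longrightarrow> rep B R f \<Longrightarrow> rep B R (f + g)"
  by (induction rule: rep.induct) (auto simp: add.assoc[symmetric] intro: rep_step)

lemma rep_mono:
  assumes "rep B R f" "\<And>b w. b \<in> B \<Longrightarrow> R (w + lm b) \<Longrightarrow> b \<in> B' \<and> R' (w + lm b)"
  shows "rep B' R' f"
  using assms(1) by induction (auto intro: rep_zero rep_step assms(2)[THEN conjunct1] assms(2)[THEN conjunct2])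

lemma rep_single_mult:
  assumes "rep B R f" "\<And>t. R t \<Longrightarrow> R' (s + t)"
  shows "rep B R' (Poly_Mapping.single s c * f)"
  using assms(1)
proof induction
  case (rep_step f b w d)
  have "rep B R' (Poly_Mapping.single s c * f + Poly_Mapping.single (s + w) (c * d) * b)"
    using rep_step assms(2)[OF rep_step.hyps(3)] by (intro rep.rep_step) (auto simp: add.assoc)
  then show ?case by (simp add: distrib_left mult_single flip: mult.assoc)
qed (simp add: rep_zero)

lemma rep_uminus: "rep B R f \<Longrightarrow> rep B R (- f)"
proof -
  assume "rep B R f"
  then have "rep B R (Poly_Mapping.single 0 (- 1) * f)" by (rule rep_single_mult) simp
  then show ?thesis by (simp add: single_uminus)
qed

lemma rep_diff: "rep B R f \<Longrightarrow> rep B R g \<Longrightarrow> rep B R (f - g)"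
  using rep_add[OF rep_uminus, of B R g f] by simp

lemma rep_mult:
  assumes "rep B (\<lambda>_. True) f" shows "rep B (\<lambda>_. True) (g * f)"
proof -
  have sum: "rep B (\<lambda>_. True) (sum h S)" if "\<And>t. rep B (\<lambda>_. True) (h t)" for h and S :: "mon set"
    by (induction S rule: infinite_finite_induct) (auto intro: rep_zero rep_add that)
  have "g * f = (\<Sum>t\<in>Poly_Mapping.keys g. Poly_Mapping.single t (Poly_Mapping.lookup g t)) * f"
    by (simp flip: poly_mapping_sum_singles)
  also have "rep B (\<lambda>_. True) \<dots>"
    unfolding sum_distrib_right by (rule sum) (rule rep_single_mult[OF assms], rule TrueI)
  finally show ?thesis .
qed

text \<open>Since \<open>lm\<close> need not commute with \<open>\<sigma>\<close>, the bound on each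
  image is a premise: trivial for ideal membership, and derived from \<open>lm_perm_poly\<close>
  when the map is strictly increasing.\<close>

lemma rep_perm_poly:
  assumes "rep B R f"
    and "\<And>b w. b \<in> B \<Longrightarrow> R (w + lm b) \<Longrightarrow>
      perm_poly \<sigma> b \<in> B' \<and> R' (perm_mon \<sigma> w + lm (perm_poly \<sigma> b))"
  shows "rep B' R' (perm_poly \<sigma> f)"
  using assms(1)
  by induction (use assms(2) in \<open>auto simp: perm_poly_add perm_poly_mult intro!: rep_zero rep_step\<close>)

lemma rep_keys_less:
  assumes "rep B (\<lambda>s. mon_less s t) f" "0 \<notin> B" "u \<in> Poly_Mapping.keys f"
  shows "mon_less u t"
  using assms(1,3)
proof (induction arbitrary: u)
  case (rep_step f b w c)
  then consider "u \<in> Poly_Mapping.keys f" | "u \<in> Poly_Mapping.keys (Poly_Mapping.single w c * b)"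
    using keys_add[of f "Poly_Mapping.single w c * b"] by blast
  then show ?case
  proof cases
    case 2
    then obtain v where "v \<in> Poly_Mapping.keys b" "u = w + v"
      using keys_single_mult[of w c b] by blast
    moreover have "b \<noteq> 0" using rep_step.hyps assms(2) by auto
    ultimately have "mon_le u (w + lm b)" using lm_ge mon_le_add by blast
    then show ?thesis using rep_step.hyps by simp
  qed (use rep_step.IH in blast)
qed simp

text \<open>There are only finitely many summands, so a strict bound sharpens to the largest
  \<open>w + lm b\<close> that occurs. This lets minimality of a bound refute a strict
  representation.\<close>

lemma rep_le_of_rep_less:
  assumes "rep B (\<lambda>s. mon_less s t) f"
  shows "f = 0 \<or> (\<exists>t'. mon_less t' t \<and> rep B (\<lambda>s. mon_le s t') f)"
  using assms
proof induction
  case (rep_step f b w c)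
  have gen: "rep B (\<lambda>s. mon_le s t') (Poly_Mapping.single w c * b)" if "mon_le (w + lm b) t'" for t'
    using rep_step.hyps that by (intro rep_generator) auto
  from rep_step.IH show ?case
  proof
    assume "f = 0"
    then show ?thesis using gen[OF mon.order_refl] rep_step.hyps(3) by auto
  next
    assume "\<exists>t'. mon_less t' t \<and> rep B (\<lambda>s. mon_le s t') f"
    then obtain t' where t': "mon_less t' t" "rep B (\<lambda>s. mon_le s t') f" by blast
    let ?m = "mon.max t' (w + lm b)"
    have "rep B (\<lambda>s. mon_le s ?m) f"
      by (rule rep_mono[OF t'(2)]) (auto intro: mon.order_trans)
    then have "rep B (\<lambda>s. mon_le s ?m) (f + Poly_Mapping.single w c * b)"
      by (intro rep_add gen) simp_all
    moreover have "mon_less ?m t" using t'(1) rep_step.hyps(3) by simp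
    ultimately show ?thesis by blast
  qed
qed simp

text \<open>The criterion asks for a representation below the lcm rather than for a zero remainder,
  because representations can be transported along strictly increasing maps. Excluding 0 keeps every
  \<open>lm b\<close> meaningful.\<close>

locale buchberger =
  fixes B :: "'k::field rpoly set"
  assumes zero_notin: "0 \<notin> B"
    and rep_spoly: "\<And>f h. f \<in> B \<Longrightarrow> h \<in> B \<Longrightarrow>
      rep B (\<lambda>s. mon_less s (mon_lcm (lm f) (lm h))) (spoly f h)"
begin

text \<open>Two generator multiples with the same leading monomial \<open>t\<close> differ, after
  scaling, by a monomial multiple of their S-polynomial; the cofactor is \<open>t\<close> divided by
  the lcm.\<close>

lemma rep_exchange:
  assumes "b \<in> B" "b' \<in> B" "w + lm b = t" "w' + lm b' = t"
  shows "rep B (\<lambda>s. mon_less s t)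
    (Poly_Mapping.single w c * b - Poly_Mapping.single w' (c * lc b / lc b') * b')"
proof -
  let ?L = "mon_lcm (lm b) (lm b')"
  define u where "u = t - ?L"
  have t: "Poly_Mapping.lookup t i = Poly_Mapping.lookup w i + Poly_Mapping.lookup (lm b) i"
    "Poly_Mapping.lookup t i = Poly_Mapping.lookup w' i + Poly_Mapping.lookup (lm b') i" for i
    using assms(3,4) by (metis lookup_add)+
  have "Poly_Mapping.lookup w i = Poly_Mapping.lookup (u + (lm b' - lm b)) i"
    "Poly_Mapping.lookup w' i = Poly_Mapping.lookup (u + (lm b - lm b')) i"
    "Poly_Mapping.lookup (u + ?L) i = Poly_Mapping.lookup t i" for i
    using t[of i] unfolding u_def mon_lcm_def lookup_add lookup_minus by linarith+
  then have "w = u + (lm b' - lm b)" and "w' = u + (lm b - lm b')" and L: "u + ?L = t"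
    by (simp_all add: poly_mapping_eqI)
  moreover have "lc b' \<noteq> 0" using assms(2) zero_notin lc_neq_0 by metis
  ultimately have "Poly_Mapping.single w c * b - Poly_Mapping.single w' (c * lc b / lc b') * b'
      = Poly_Mapping.single u (c / lc b') * spoly b b'"
    by (simp add: spoly_def right_diff_distrib mult_single flip: mult.assoc)
  moreover have "rep B (\<lambda>s. mon_less s t) (Poly_Mapping.single u (c / lc b') * spoly b b')"
    using rep_spoly[OF assms(1,2)] by (rule rep_single_mult) (use mon_less_add[of _ ?L u] L in simp)
  ultimately show ?thesis by simp
qed

text \<open>Every summand that reaches \<open>t\<close> is exchanged for a multiple of the single
  generator \<open>b'\<close>. The coefficient at \<open>t\<close> is additive, so the claim is
  proved summand by summand and no telescoping sum is needed.\<close>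

lemma rep_cancel_top:
  assumes "rep B (\<lambda>s. mon_le s t) f" "b' \<in> B" "w' + lm b' = t"
  shows "rep B (\<lambda>s. mon_less s t)
    (f - Poly_Mapping.single w' (Poly_Mapping.lookup f t / lc b') * b')"
  using assms(1)
proof induction
  case (rep_step f b w c)
  let ?p = "\<lambda>a. Poly_Mapping.single w' (a / lc b') * b'" and ?g = "Poly_Mapping.single w c * b"
  have split: "f + ?g - ?p (Poly_Mapping.lookup (f + ?g) t)
      = (f - ?p (Poly_Mapping.lookup f t)) + (?g - ?p (Poly_Mapping.lookup ?g t))"
    by (simp add: lookup_add add_divide_distrib single_add distrib_right)
  have "rep B (\<lambda>s. mon_less s t) (?g - ?p (Poly_Mapping.lookup ?g t))"
  proof (cases "w + lm b = t")
    case True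
    moreover from this have "Poly_Mapping.lookup ?g t = c * lc b" by (metis lookup_single_mult)
    ultimately show ?thesis using rep_exchange[OF rep_step.hyps(2) assms(2) _ assms(3), of w c] by simp
  next
    case False
    then have less: "mon_less (w + lm b) t" using rep_step.hyps(3) by simp
    then have g: "rep B (\<lambda>s. mon_less s t) ?g" using rep_step.hyps(2) by (intro rep_generator)
    have "t \<notin> Poly_Mapping.keys ?g" using rep_keys_less[OF g zero_notin] by blast
    then show ?thesis using g by (simp add: in_keys_iff)
  qed
  then show ?case unfolding split using rep_step.IH by (rule rep_add)
qed (simp add: rep_zero)

text \<open>Take the least \<open>t\<close> bounding some representation of \<open>f\<close>. By
  minimality some summand reaches \<open>t\<close>, and the coefficient of \<open>f\<close> at
  \<open>t\<close> is nonzero, since otherwise \<open>rep_cancel_top\<close> would give a strict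
  representation. As \<open>t\<close> bounds all monomials of \<open>f\<close>, it is
  \<open>lm f\<close>.\<close>

theorem ex_lm_dvd:
  assumes "rep B (\<lambda>_. True) f" "f \<noteq> 0"
  shows "\<exists>b\<in>B. \<exists>w. w + lm b = lm f"
proof -
  let ?P = "\<lambda>t. rep B (\<lambda>s. mon_le s t) f"
  have "f \<noteq> 0 \<longrightarrow> (\<exists>t. ?P t)"
    using assms(1)
  proof induction
    case (rep_step f b w c)
    then obtain t where "f = 0 \<or> rep B (\<lambda>s. mon_le s t) f" by blast
    then have "rep B (\<lambda>s. mon_le s (mon.max t (w + lm b))) f"
      by (auto intro: rep_zero elim!: rep_mono intro: mon.order_trans)
    moreover have "rep B (\<lambda>s. mon_le s (mon.max t (w + lm b))) (Poly_Mapping.single w c * b)"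
      using rep_step.hyps by (intro rep_generator) auto
    ultimately show ?case using rep_add by blast
  qed simp
  then obtain t0 where "?P t0" using assms(2) by blast
  then obtain t where t: "?P t" and minimal: "\<And>s. mon_less s t \<Longrightarrow> \<not> ?P s"
    using wfp_eq_minimal[THEN iffD1, OF wf_mon_less, rule_format, of t0 "Collect ?P"] by auto
  have not_less: "\<not> rep B (\<lambda>s. mon_less s t) f"
    using rep_le_of_rep_less assms(2) minimal by blast
  have ex: "\<exists>b\<in>B. \<exists>w. w + lm b = t"
  proof (rule ccontr)
    assume none: "\<not> ?thesis"
    have "rep B (\<lambda>s. mon_less s t) f"
      by (rule rep_mono[OF t]) (use none in \<open>auto simp: mon.less_le\<close>)
    then show False using not_less by blast
  qed
  then obtain b w where b: "b \<in> B" "w + lm b = t" by blast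
  have cancel: "rep B (\<lambda>s. mon_less s t) (f - Poly_Mapping.single w (Poly_Mapping.lookup f t / lc b) * b)"
    using t b by (rule rep_cancel_top)
  have "Poly_Mapping.lookup f t \<noteq> 0" using cancel not_less by auto
  then have "t \<in> Poly_Mapping.keys f" by (simp add: in_keys_iff)
  moreover have "mon_le u t" if "u \<in> Poly_Mapping.keys f" for u
  proof (rule ccontr)
    assume "\<not> mon_le u t"
    then have tu: "mon_less t u" by simp
    have "rep B (\<lambda>s. mon_less s u) f"
      by (rule rep_mono[OF t]) (use tu in auto)
    then show False using rep_keys_less[OF _ zero_notin that] by auto
  qed
  ultimately have "lm f = t" by (rule lm_eqI)
  then show ?thesis using ex by simp
qed

end

text \<open>A division step is undone: because \<open>lm h\<close> divides \<open>lm f\<close>,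
  adding back the multiple of \<open>h\<close> leaves \<open>lc h\<close> times \<open>f\<close>,
  and every summand stays below \<open>lm f\<close>.\<close>

lemma rep_of_rep_spoly:
  assumes "f \<noteq> 0" "h \<noteq> 0" "h \<in> B" "mon_dvd (lm h) (lm f)"
    and "spoly f h = 0 \<or> rep B (\<lambda>s. mon_le s (lm (spoly f h))) (spoly f h)"
  shows "rep B (\<lambda>s. mon_le s (lm f)) f"
proof -
  have "rep B (\<lambda>s. mon_le s (lm f)) (spoly f h)"
  proof (cases "spoly f h = 0")
    case False
    then have "mon_less (lm (spoly f h)) (lm f)" using assms lm_spoly_less by blast
    then show ?thesis using assms(5) False by (auto elim!: rep_mono)
  qed (simp add: rep_zero)
  moreover have "rep B (\<lambda>s. mon_le s (lm f)) (Poly_Mapping.single (lm f - lm h) (lc f) * h)"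
    using assms(3,4) mon_lcm_absorb[of "lm h" "lm f"] mon_lcm_commute[of "lm f" "lm h"]
    by (intro rep_generator) (simp_all add: mon_lcm_def)
  ultimately have "rep B (\<lambda>s. mon_le s (lm f)) (Poly_Mapping.single 0 (1 / lc h) *
      (spoly f h + Poly_Mapping.single (lm f - lm h) (lc f) * h))"
    by (intro rep_single_mult[OF rep_add]) simp_all
  moreover have "lm h - lm f = 0"
    using assms(4) by (intro poly_mapping_eqI) (simp add: lookup_minus mon_dvd_iff)
  ultimately show ?thesis
    using lc_neq_0[OF assms(2)] by (simp add: spoly_def mult_single flip: mult.assoc)
qed

section \<open>Symmetric ideals\<close>

text \<open>The complements of \<open>{..<n}\<close> and of its image inside \<open>{..<m}\<close>
  have equal cardinality and are matched; above \<open>m\<close> the map is the identity. That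
  \<open>\<psi>\<close> preserves \<open>{..<m}\<close> is used for the termination of the
  completion.\<close>

lemma ex_bij_extending:
  fixes \<pi> :: "nat \<Rightarrow> nat"
  assumes "inj_on \<pi> {..<n}" "\<pi> ` {..<n} \<subseteq> {..<m}"
  obtains \<psi> where "bij \<psi>" "\<And>i. i < n \<Longrightarrow> \<psi> i = \<pi> i" "\<And>i. i < m \<Longrightarrow> \<psi> i < m"
proof -
  have card: "card (\<pi> ` {..<n}) = n" using assms(1) by (simp add: card_image)
  then have "n \<le> m" using card_mono[OF _ assms(2)] by simp
  have "card ({..<m} - {..<n}) = card ({..<m} - \<pi> ` {..<n})"
    using card \<open>n \<le> m\<close> assms(2) by (simp add: card_Diff_subset)
  then obtain g where g: "bij_betw g ({..<m} - {..<n}) ({..<m} - \<pi> ` {..<n})"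
    using finite_same_card_bij[of "{..<m} - {..<n}" "{..<m} - \<pi> ` {..<n}"] by auto
  define \<psi> where "\<psi> i = (if i < n then \<pi> i else if i < m then g i else i)" for i
  have low: "bij_betw \<psi> {..<n} (\<pi> ` {..<n})"
    using assms(1) by (auto simp: bij_betw_def inj_on_def \<psi>_def)
  have mid: "bij_betw \<psi> ({..<m} - {..<n}) ({..<m} - \<pi> ` {..<n})"
    using g by (rule bij_betw_cong[THEN iffD1, rotated]) (simp add: \<psi>_def)
  have high: "bij_betw \<psi> {m..} {m..}"
    using \<open>n \<le> m\<close> by (auto simp: bij_betw_def inj_on_def \<psi>_def image_iff)
  have "bij_betw \<psi> ({..<n} \<union> ({..<m} - {..<n})) (\<pi> ` {..<n} \<union> ({..<m} - \<pi> ` {..<n}))"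
    using low mid by (rule bij_betw_combine) blast
  moreover have "{..<n} \<union> ({..<m} - {..<n}) = {..<m}" using \<open>n \<le> m\<close> by auto
  moreover have "\<pi> ` {..<n} \<union> ({..<m} - \<pi> ` {..<n}) = {..<m}" using assms(2) by auto
  ultimately have below: "bij_betw \<psi> {..<m} {..<m}" by simp
  then have "bij_betw \<psi> ({..<m} \<union> {m..}) ({..<m} \<union> {m..})"
    using high by (rule bij_betw_combine) auto
  moreover have "{..<m} \<union> {m..} = UNIV" by auto
  ultimately have "bij \<psi>" by simp
  moreover have "\<psi> i < m" if "i < m" for i using bij_betwE[OF below] that by simp
  ultimately show thesis using that[of \<psi>] by (simp add: \<psi>_def)
qed

text \<open>The map enumerates \<open>A\<close> followed by all indices beyond it. Since
  \<open>A\<close> is an initial segment of this set, its elements occupy the first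
  \<open>card A\<close> positions.\<close>

lemma ex_strict_mono_covering:
  fixes A :: "nat set"
  assumes "finite A" "card A \<le> m"
  obtains \<rho> :: "nat \<Rightarrow> nat" where "strict_mono \<rho>" "A \<subseteq> \<rho> ` {..<m}"
proof
  define S where "S = A \<union> {i. \<forall>a\<in>A. a < i}"
  obtain b where "\<forall>a\<in>A. a < b" using finite_nat_set_iff_bounded[of A] assms(1) by blast
  then have "{b..} \<subseteq> S" by (auto simp: S_def)
  then have inf: "infinite S" using infinite_Ici[of b] finite_subset by blast
  show "strict_mono (enumerate S)" by (simp add: strict_mono_def enumerate_mono inf)
  show "A \<subseteq> enumerate S ` {..<m}"
  proof
    fix a assume a: "a \<in> A"
    then obtain n where n: "enumerate S n = a" using enumerate_Ex[OF inf, of a] by (auto simp: S_def)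
    have "enumerate S i \<in> A" if "i \<le> n" for i
    proof -
      have "enumerate S i \<le> a" using that n inf by auto
      then show ?thesis using enumerate_in_set[OF inf, of i] a by (auto simp: S_def)
    qed
    then have "enumerate S ` {..n} \<subseteq> A" by auto
    then have "card (enumerate S ` {..n}) \<le> card A" using assms(1) by (intro card_mono)
    then have "Suc n \<le> card A" using inj_enumerate[OF inf] by (simp add: card_image inj_on_subset)
    then show "a \<in> enumerate S ` {..<m}" using n assms(2) by auto
  qed
qed

lemma ex_factor_through:
  assumes "strict_mono (\<rho> :: nat \<Rightarrow> nat)" "inj_on \<sigma> {..<n}" "\<sigma> ` {..<n} \<subseteq> \<rho> ` {..<m}"
  obtains \<tau> :: "nat \<Rightarrow> nat" where "inj_on \<tau> {..<n}" "\<tau> ` {..<n} \<subseteq> {..<m}" "\<And>i. i < n \<Longrightarrow> \<rho> (\<tau> i) = \<sigma> i"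
proof
  let ?\<tau> = "inv_into {..<m} \<rho> \<circ> \<sigma>"
  show eq: "\<rho> (?\<tau> i) = \<sigma> i" if "i < n" for i
    using assms(3) that by (auto simp: image_subset_iff intro: f_inv_into_f)
  show "inj_on ?\<tau> {..<n}"
    using eq assms(2) by (metis inj_on_def lessThan_iff)
  show "?\<tau> ` {..<n} \<subseteq> {..<m}"
    using assms(3) by (auto simp: image_subset_iff intro: inv_into_into[of _ \<rho> "{..<m}", simplified])
qed

section \<open>Orbits under injections and the ideals they generate\<close>

definition in_vars :: "nat \<Rightarrow> 'k::zero rpoly \<Rightarrow> bool" where
  "in_vars n f \<longleftrightarrow> (\<forall>t\<in>Poly_Mapping.keys f. Poly_Mapping.keys t \<subseteq> {..<n})"

lemma ex_in_vars: "\<exists>n. in_vars n f"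
proof -
  have "finite (\<Union>t\<in>Poly_Mapping.keys f. Poly_Mapping.keys t)" by simp
  then obtain n where "(\<Union>t\<in>Poly_Mapping.keys f. Poly_Mapping.keys t) \<subseteq> {..<n}"
    using finite_nat_bounded by blast
  then show ?thesis unfolding in_vars_def by blast
qed

lemma in_vars_perm_poly_cong:
  assumes "in_vars n f" "\<And>i. i < n \<Longrightarrow> \<sigma> i = \<tau> i" shows "perm_poly \<sigma> f = perm_poly \<tau> f"
  using assms by (intro perm_poly_cong) (auto simp: in_vars_def)

lemma in_vars_perm_poly:
  assumes "in_vars n f" "\<sigma> ` {..<n} \<subseteq> {..<m}" shows "in_vars m (perm_poly \<sigma> f)"
  unfolding in_vars_def
proof
  fix u assume "u \<in> Poly_Mapping.keys (perm_poly \<sigma> f)"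
  then obtain t where "t \<in> Poly_Mapping.keys f" "u = perm_mon \<sigma> t" using keys_perm_poly by blast
  then show "Poly_Mapping.keys u \<subseteq> {..<m}"
    using assms keys_perm_mon[of \<sigma> t] by (fastforce simp: in_vars_def)
qed

text \<open>A polynomial has finitely many indeterminates, so injections give the same images as
  permutations.  Unlike permutations, they factor into an order preserving map after a map
  between bounded sets of indices.\<close>

definition sym_orbit :: "'k::comm_ring_1 rpoly set \<Rightarrow> 'k rpoly set" where
  "sym_orbit F = {perm_poly \<sigma> g |\<sigma> g. inj \<sigma> \<and> g \<in> F} - {0}"

definition bounded_orbit :: "nat \<Rightarrow> nat \<Rightarrow> 'k::comm_ring_1 rpoly set \<Rightarrow> 'k rpoly set" where
  "bounded_orbit n m F =
     {perm_poly \<sigma> g |\<sigma> g. inj_on \<sigma> {..<n} \<and> \<sigma> ` {..<n} \<subseteq> {..<m} \<and> g \<in> F} - {0}"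

lemma sym_orbitI: "inj \<sigma> \<Longrightarrow> g \<in> F \<Longrightarrow> perm_poly \<sigma> g \<noteq> 0 \<Longrightarrow> perm_poly \<sigma> g \<in> sym_orbit F"
  by (auto simp: sym_orbit_def)

lemma perm_poly_sym_orbit:
  assumes "inj \<sigma>" "b \<in> sym_orbit F" shows "perm_poly \<sigma> b \<in> sym_orbit F"
proof -
  obtain \<tau> g where b: "b = perm_poly \<tau> g" "inj \<tau>" "g \<in> F" "b \<noteq> 0" using assms(2) by (auto simp: sym_orbit_def)
  have "perm_poly \<sigma> b \<noteq> 0" using b(4) by (simp add: perm_poly_eq_0_iff[OF assms(1)])
  then show ?thesis
    using sym_orbitI[OF inj_compose[OF assms(1) b(2)] b(3)] by (simp add: b(1) perm_poly_perm_poly)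
qed

lemma bounded_orbit_subset:
  assumes "\<And>g. g \<in> F \<Longrightarrow> in_vars n g" shows "bounded_orbit n m F \<subseteq> sym_orbit F"
proof
  fix b assume b: "b \<in> bounded_orbit n m F"
  then obtain \<sigma> g where \<sigma>: "b = perm_poly \<sigma> g" "inj_on \<sigma> {..<n}" "\<sigma> ` {..<n} \<subseteq> {..<m}" "g \<in> F"
    by (auto simp: bounded_orbit_def)
  obtain \<psi> where \<psi>: "bij \<psi>" "\<And>i. i < n \<Longrightarrow> \<psi> i = \<sigma> i" 
    by (rule ex_bij_extending[OF \<sigma>(2,3)]) blast
  have "b = perm_poly \<psi> g" using \<sigma>(1) in_vars_perm_poly_cong[OF assms[OF \<sigma>(4)] \<psi>(2)] by simp
  moreover have "b \<noteq> 0" using b by (simp add: bounded_orbit_def)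
  ultimately show "b \<in> sym_orbit F"
    using sym_orbitI[OF bij_is_inj[OF \<psi>(1)] \<sigma>(4)] by auto
qed

lemma subspace_times_iff:
  "module.subspace (*) (I :: 'a::comm_ring_1 set) \<longleftrightarrow>
    0 \<in> I \<and> (\<forall>x\<in>I. \<forall>y\<in>I. x + y \<in> I) \<and> (\<forall>c. \<forall>x\<in>I. c * x \<in> I)"
proof -
  have "module ((*) :: 'a \<Rightarrow> 'a \<Rightarrow> 'a)" by unfold_locales (simp_all add: algebra_simps)
  then show ?thesis by (rule module.subspace_def)
qed

lemma symmetric_ideal_rep_sym_orbit: "symmetric_ideal {f. rep (sym_orbit F) (\<lambda>_. True) f}"
  by (auto simp: symmetric_ideal_def subspace_times_iff
      intro: rep_zero rep_add rep_mult rep_perm_poly perm_poly_sym_orbit bij_is_inj)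

text \<open>The representable polynomials form a symmetric ideal containing \<open>F\<close>.
  Conversely, a symmetric ideal containing \<open>F\<close> contains each orbit element, because on
  the finitely many indeterminates of \<open>g\<close> the injection agrees with a
  permutation.\<close>

lemma symmetric_ideal_of_eq:
  fixes F :: "'k::field rpoly set"
  shows "symmetric_ideal_of F = {f. rep (sym_orbit F) (\<lambda>_. True) f}"
proof
  let ?I = "{f. rep (sym_orbit F) (\<lambda>_. True) f}"
  have "F \<subseteq> ?I"
  proof
    fix g assume "g \<in> F"
    then show "g \<in> ?I"
      using rep_generator[of g "sym_orbit F" "\<lambda>_. True" 0 1] sym_orbitI[of id g F]
      by (cases "g = 0") (auto intro: rep_zero)
  qed
  then show "symmetric_ideal_of F \<subseteq> ?I"
    unfolding symmetric_ideal_of_def using symmetric_ideal_rep_sym_orbit by (rule hull_minimal)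
  show "?I \<subseteq> symmetric_ideal_of F"
    unfolding symmetric_ideal_of_def hull_def
  proof (intro subsetI InterI)
    fix f I assume f: "f \<in> ?I" and "I \<in> {I. symmetric_ideal I \<and> F \<subseteq> I}"
    then have I: "0 \<in> I" "\<And>x y. x \<in> I \<Longrightarrow> y \<in> I \<Longrightarrow> x + y \<in> I" "\<And>c x. x \<in> I \<Longrightarrow> c * x \<in> I"
      "\<And>\<sigma> x. bij \<sigma> \<Longrightarrow> x \<in> I \<Longrightarrow> perm_poly \<sigma> x \<in> I" "F \<subseteq> I"
      by (auto simp: symmetric_ideal_def subspace_times_iff)
    have orbit: "b \<in> I" if b: "b \<in> sym_orbit F" for b
    proof -
      obtain \<sigma> g where \<sigma>: "b = perm_poly \<sigma> g" "inj \<sigma>" "g \<in> F" using b by (auto simp: sym_orbit_def)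
      obtain n where n: "in_vars n g" using ex_in_vars by blast
      obtain m where m: "\<sigma> ` {..<n} \<subseteq> {..<m}" using finite_nat_bounded[of "\<sigma> ` {..<n}"] by auto
      obtain \<psi> where \<psi>: "bij \<psi>" "\<And>i. i < n \<Longrightarrow> \<psi> i = \<sigma> i"
        by (rule ex_bij_extending[OF inj_on_subset[OF \<sigma>(2) subset_UNIV] m]) blast
      have "b = perm_poly \<psi> g" using \<sigma>(1) in_vars_perm_poly_cong[OF n \<psi>(2)] by simp
      then show ?thesis using I \<psi>(1) \<sigma>(3) by blast
    qed
    from f have "rep (sym_orbit F) (\<lambda>_. True) f" by simp
    then show "f \<in> I" by induction (use I orbit in auto)
  qed
qed

section \<open>Deciding membership by reduction with the bounded images\<close>

lemma zero_notin_sym_orbit: "0 \<notin> sym_orbit F"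
  by (simp add: sym_orbit_def)

locale bounded_buchberger =
  fixes N :: nat and G :: "'k::field rpoly set"
  assumes vars: "\<And>g. g \<in> G \<Longrightarrow> in_vars N g"
    and rep_spoly: "\<And>f h. f \<in> bounded_orbit N (2 * N) G \<Longrightarrow> h \<in> bounded_orbit N (2 * N) G \<Longrightarrow>
      rep (bounded_orbit N (2 * N) G) (\<lambda>s. mon_less s (mon_lcm (lm f) (lm h))) (spoly f h)"
begin

abbreviation "H \<equiv> bounded_orbit N (2 * N) G"

sublocale orbit: buchberger "sym_orbit G"
proof
  show "0 \<notin> sym_orbit G" by (rule zero_notin_sym_orbit)
  fix f h assume f: "f \<in> sym_orbit G" and h: "h \<in> sym_orbit G"
  obtain \<sigma> g where \<sigma>: "f = perm_poly \<sigma> g" "inj \<sigma>" "g \<in> G" using f by (auto simp: sym_orbit_def)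
  obtain \<sigma>' g' where \<sigma>': "h = perm_poly \<sigma>' g'" "inj \<sigma>'" "g' \<in> G" using h by (auto simp: sym_orbit_def)
  let ?A = "\<sigma> ` {..<N}" and ?A' = "\<sigma>' ` {..<N}"
  have "card (?A \<union> ?A') \<le> card ?A + card ?A'" by (rule card_Un_le)
  also have "\<dots> \<le> 2 * N" using card_image_le[of "{..<N}" \<sigma>] card_image_le[of "{..<N}" \<sigma>'] by simp
  finally obtain \<rho> where \<rho>: "strict_mono \<rho>" "?A \<union> ?A' \<subseteq> \<rho> ` {..<2 * N}"
    using ex_strict_mono_covering[of "?A \<union> ?A'" "2 * N"] by auto
  have inj: "inj \<rho>" using \<rho>(1) by (rule strict_mono_imp_inj_on)
  obtain \<tau> where \<tau>: "inj_on \<tau> {..<N}" "\<tau> ` {..<N} \<subseteq> {..<2 * N}" "\<And>i. i < N \<Longrightarrow> \<rho> (\<tau> i) = \<sigma> i"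
    using ex_factor_through[OF \<rho>(1) inj_on_subset[OF \<sigma>(2)], of N "2 * N"] \<rho>(2) by auto
  obtain \<tau>' where \<tau>': "inj_on \<tau>' {..<N}" "\<tau>' ` {..<N} \<subseteq> {..<2 * N}" "\<And>i. i < N \<Longrightarrow> \<rho> (\<tau>' i) = \<sigma>' i"
    using ex_factor_through[OF \<rho>(1) inj_on_subset[OF \<sigma>'(2)], of N "2 * N"] \<rho>(2) by auto
  let ?f = "perm_poly \<tau> g" and ?h = "perm_poly \<tau>' g'"
  have f': "f = perm_poly \<rho> ?f" and h': "h = perm_poly \<rho> ?h"
    using in_vars_perm_poly_cong[OF vars[OF \<sigma>(3)], of \<sigma> "\<rho> \<circ> \<tau>"]
      in_vars_perm_poly_cong[OF vars[OF \<sigma>'(3)], of \<sigma>' "\<rho> \<circ> \<tau>'"] \<tau>(3) \<tau>'(3) \<sigma>(1) \<sigma>'(1)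
    by (simp_all add: perm_poly_perm_poly)
  have ne: "?f \<noteq> 0" "?h \<noteq> 0" using f f' h h' zero_notin_sym_orbit by force+
  then have "?f \<in> H" "?h \<in> H" using \<sigma>(3) \<sigma>'(3) \<tau> \<tau>' by (auto simp: bounded_orbit_def)
  then have "rep H (\<lambda>s. mon_less s (mon_lcm (lm ?f) (lm ?h))) (spoly ?f ?h)" by (rule rep_spoly)
  \<comment> \<open>The whole certificate is pushed along \<open>\<rho>\<close>: leading monomials,
    lcm and order all commute with a strictly increasing map.\<close>
  then have "rep (sym_orbit G) (\<lambda>s. mon_less s (mon_lcm (lm f) (lm h))) (perm_poly \<rho> (spoly ?f ?h))"
  proof (rule rep_perm_poly)
    fix b w assume b: "b \<in> H" and less: "mon_less (w + lm b) (mon_lcm (lm ?f) (lm ?h))"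
    have "b \<in> sym_orbit G" using b bounded_orbit_subset[OF vars] by blast
    then have "perm_poly \<rho> b \<in> sym_orbit G" by (rule perm_poly_sym_orbit[OF inj])
    moreover have "mon_less (perm_mon \<rho> w + lm (perm_poly \<rho> b)) (mon_lcm (lm f) (lm h))"
    proof -
      have "b \<noteq> 0" using b by (simp add: bounded_orbit_def)
      then show ?thesis
        using mon_less_perm_mon[OF \<rho>(1) less] ne
        by (simp add: f' h' lm_perm_poly[OF \<rho>(1)] perm_mon_add perm_mon_lcm[OF inj])
    qed
    ultimately show "perm_poly \<rho> b \<in> sym_orbit G \<and>
      mon_less (perm_mon \<rho> w + lm (perm_poly \<rho> b)) (mon_lcm (lm f) (lm h))" ..
  qed
  then show "rep (sym_orbit G) (\<lambda>s. mon_less s (mon_lcm (lm f) (lm h))) (spoly f h)"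
    using perm_spoly[OF \<rho>(1) ne] f' h' by simp
qed

lemma ex_witnesses:
  assumes "f \<in> symmetric_ideal_of G" "f \<noteq> 0"
  obtains h \<psi> w where "h \<in> H" "witnesses \<psi> (lm h) (lm f)" "w + perm_mon \<psi> (lm h) = lm f"
proof -
  obtain b w where b: "b \<in> sym_orbit G" and w: "w + lm b = lm f"
    using orbit.ex_lm_dvd[of f] assms by (auto simp: symmetric_ideal_of_eq)
  obtain \<sigma> g where \<sigma>: "b = perm_poly \<sigma> g" "inj \<sigma>" "g \<in> G" using b by (auto simp: sym_orbit_def)
  obtain \<rho> where \<rho>: "strict_mono \<rho>" "\<sigma> ` {..<N} \<subseteq> \<rho> ` {..<N}"
    using ex_strict_mono_covering[of "\<sigma> ` {..<N}" N] card_image_le[of "{..<N}" \<sigma>] by auto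
  have inj: "inj \<rho>" using \<rho>(1) by (rule strict_mono_imp_inj_on)
  obtain \<tau> where \<tau>: "inj_on \<tau> {..<N}" "\<tau> ` {..<N} \<subseteq> {..<N}" "\<And>i. i < N \<Longrightarrow> \<rho> (\<tau> i) = \<sigma> i"
    using ex_factor_through[OF \<rho>(1) inj_on_subset[OF \<sigma>(2)] \<rho>(2)] by auto
  let ?h = "perm_poly \<tau> g"
  have b': "b = perm_poly \<rho> ?h"
    using in_vars_perm_poly_cong[OF vars[OF \<sigma>(3)], of \<sigma> "\<rho> \<circ> \<tau>"] \<tau>(3) \<sigma>(1)
    by (simp add: perm_poly_perm_poly)
  have ne: "?h \<noteq> 0" using b b' zero_notin_sym_orbit by force
  \<comment> \<open>A single image occupies at most \<open>N\<close> indices, so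
    \<open>\<tau>\<close> takes values below \<open>N\<close>; \<open>H\<close> has the larger range
    that pairs need.\<close>
  have "{..<N} \<subseteq> {..<2 * N}" by auto
  then have h: "?h \<in> H" using ne \<tau>(1,2) \<sigma>(3) by (fastforce simp: bounded_orbit_def)
  obtain m where m: "\<rho> ` {..<N} \<subseteq> {..<m}" using finite_nat_bounded[of "\<rho> ` {..<N}"] by auto
  obtain \<psi> where \<psi>: "bij \<psi>" "\<And>i. i < N \<Longrightarrow> \<psi> i = \<rho> i"
    by (rule ex_bij_extending[OF inj_on_subset[OF inj subset_UNIV] m]) blast
  have "in_vars N ?h" using in_vars_perm_poly[OF vars[OF \<sigma>(3)] \<tau>(2)] .
  then have "Poly_Mapping.keys (lm ?h) \<subseteq> {..<N}" using lm_in_keys[OF ne] by (simp add: in_vars_def)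
  \<comment> \<open>All monomials up to \<open>lm ?h\<close> live on the indices below
    \<open>N\<close>, where the permutation \<open>\<psi>\<close> coincides with the order
    preserving \<open>\<rho>\<close>.\<close>
  then have agree: "perm_mon \<psi> u = perm_mon \<rho> u" if "mon_le u (lm ?h)" for u
    using mon_keys_below_mono[OF that] \<psi>(2) by (intro perm_mon_cong) auto
  have lm_f: "w + perm_mon \<psi> (lm ?h) = lm f" using w agree[of "lm ?h"] by (simp add: b' lm_perm_poly[OF \<rho>(1) ne])
  moreover have "witnesses \<psi> (lm ?h) (lm f)"
    unfolding witnesses_def
  proof (intro conjI allI impI)
    show "mon_le (lm ?h) (lm f)"
      unfolding lm_f[symmetric] agree[OF mon.order_refl]
      using mon_le_perm_mon_self[OF \<rho>(1)] mon_le_add_self by (rule mon.order_trans)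
    show "mon_dvd (perm_mon \<psi> (lm ?h)) (lm f)" unfolding mon_dvd_def using lm_f by metis
    show "mon_le (perm_mon \<psi> u) (perm_mon \<psi> (lm ?h))" if "mon_le u (lm ?h)" for u
      using mon_le_perm_mon[OF \<rho>(1) that] agree[OF that] agree[of "lm ?h"] by simp
  qed (rule \<psi>(1))
  ultimately show thesis using that h by blast
qed

lemma reduces_in_ideal_iff:
  assumes "reduces H f h"
  shows "f \<in> symmetric_ideal_of G \<longleftrightarrow> h \<in> symmetric_ideal_of G"
proof -
  obtain g \<sigma> a w where g: "g \<in> H" "bij \<sigma>" and h: "h = f - Poly_Mapping.single w a * perm_poly \<sigma> g"
    using assms by (auto simp: reduces_def witnesses_def)
  have "perm_poly \<sigma> g \<in> sym_orbit G"
    using g bounded_orbit_subset[OF vars] perm_poly_sym_orbit[of \<sigma> g G] by (auto simp: bij_is_inj)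
  then have p: "rep (sym_orbit G) (\<lambda>_. True) (Poly_Mapping.single w a * perm_poly \<sigma> g)"
    by (intro rep_generator) simp_all
  show ?thesis
    unfolding symmetric_ideal_of_eq mem_Collect_eq
  proof
    show "rep (sym_orbit G) (\<lambda>_. True) f \<Longrightarrow> rep (sym_orbit G) (\<lambda>_. True) h"
      unfolding h using p by (rule rep_diff[rotated])
    show "rep (sym_orbit G) (\<lambda>_. True) h \<Longrightarrow> rep (sym_orbit G) (\<lambda>_. True) f"
      using rep_add[OF p, of h] by (simp add: h)
  qed
qed

text \<open>The permutation need not preserve the monomial order globally. The witness clause about
  all \<open>u\<close> below \<open>lm g\<close> is what keeps the remaining terms of the subtracted
  multiple at or below \<open>lm f\<close>.\<close>

lemma ex_reduces:
  assumes "f \<in> symmetric_ideal_of G" "f \<noteq> 0"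
  obtains h where "reduces H f h" "h = 0 \<or> mon_less (lm h) (lm f)"
proof -
  obtain g \<psi> w where g: "g \<in> H" and \<psi>: "witnesses \<psi> (lm g) (lm f)"
    and w: "w + perm_mon \<psi> (lm g) = lm f"
    using ex_witnesses[OF assms] by blast
  have ne: "g \<noteq> 0" using g by (simp add: bounded_orbit_def)
  have inj: "inj \<psi>" using \<psi> by (simp add: witnesses_def bij_is_inj)
  define a where "a = lc f / lc g"
  let ?p = "Poly_Mapping.single w a * perm_poly \<psi> g"
  have "a \<noteq> 0" using lc_neq_0[OF assms(2)] lc_neq_0[OF ne] by (simp add: a_def)
  moreover have "lt f = Poly_Mapping.single w a * perm_poly \<psi> (lt g)"
    using ne lc_neq_0[of g] w by (simp add: lt_def mult_single a_def)
  ultimately have red: "reduces H f (f - ?p)"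
    unfolding reduces_def using assms(2) g \<psi> w by blast
  have p_top: "Poly_Mapping.lookup ?p (lm f) = lc f"
    using lc_neq_0[OF ne] lookup_single_mult[of w a "perm_poly \<psi> g" "perm_mon \<psi> (lm g)"] w
    by (simp add: lookup_perm_poly_inj[OF inj] a_def)
  have "mon_less (lm (f - ?p)) (lm f)" if "f - ?p \<noteq> 0"
  proof -
    let ?t = "lm (f - ?p)"
    have t: "?t \<in> Poly_Mapping.keys (f - ?p)" using that by (rule lm_in_keys)
    have "mon_le ?t (lm f)"
    proof (cases "?t \<in> Poly_Mapping.keys f")
      case False
      then have "?t \<in> Poly_Mapping.keys ?p" using t by (simp add: in_keys_iff lookup_minus)
      then obtain u where "u \<in> Poly_Mapping.keys g" "?t = w + perm_mon \<psi> u"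
        using keys_single_mult[of w a "perm_poly \<psi> g"] keys_perm_poly[of \<psi> g] by blast
      then show ?thesis
        using \<psi> lm_ge[OF ne] mon_le_add[of "perm_mon \<psi> u" "perm_mon \<psi> (lm g)" w] w by (auto simp: witnesses_def)
    qed (rule lm_ge[OF assms(2)])
    moreover have "?t \<noteq> lm f" using t p_top by (auto simp: in_keys_iff lookup_minus)
    ultimately show ?thesis by (simp add: mon.less_le)
  qed
  then show thesis using that red by blast
qed

text \<open>Each reduction step preserves membership in both directions, so a chain to 0 proves it,
  and a nonzero member always admits a step that lowers \<open>lm\<close> or reaches 0.\<close>

theorem normal_form_iff: "f \<in> symmetric_ideal_of G \<longleftrightarrow> normal_form H f 0"
proof
  assume "f \<in> symmetric_ideal_of G"
  then have "(reduces H)\<^sup>*\<^sup>* f 0"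
  proof (induction "lm f" arbitrary: f rule: wfp_induct_rule[OF wf_mon_less])
    case (1 f)
    show ?case
    proof (cases "f = 0")
      case False
      then obtain h where h: "reduces H f h" "h = 0 \<or> mon_less (lm h) (lm f)"
        using ex_reduces "1.prems" by blast
      then have "(reduces H)\<^sup>*\<^sup>* h 0" using "1.hyps"[of h] "1.prems" reduces_in_ideal_iff by auto
      then show ?thesis using h(1) by (rule converse_rtranclp_into_rtranclp[rotated])
    qed simp
  qed
  then show "normal_form H f 0" by (simp add: normal_form_def reduced_def reduces_def)
next
  assume "normal_form H f 0"
  then have "(reduces H)\<^sup>*\<^sup>* f 0" by (simp add: normal_form_def)
  then show "f \<in> symmetric_ideal_of G"
  proof (induction rule: converse_rtranclp_induct)
    case base
    then show ?case by (simp add: symmetric_ideal_of_eq rep_zero)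
  qed (use reduces_in_ideal_iff in blast)
qed

end

section \<open>Computable functions\<close>

text \<open>One program serves all inputs and must halt on each, so only total functions qualify.
  The parameter \<open>x\<close> acts as the environment of the free variables.\<close>

definition computable :: "('a \<Rightarrow> 'k::field val) \<Rightarrow> ('b \<Rightarrow> 'k val) \<Rightarrow> ('a \<Rightarrow> 'b) \<Rightarrow> bool" where
  "computable ea eb f \<longleftrightarrow> (\<exists>p. \<forall>x. exec p (ea x) (eb (f x)))"

definition enc_bool :: "bool \<Rightarrow> 'k val" where
  "enc_bool b = VNat (if b then 1 else 0)"

definition enc_pair :: "('a \<Rightarrow> 'k val) \<Rightarrow> ('b \<Rightarrow> 'k val) \<Rightarrow> 'a \<times> 'b \<Rightarrow> 'k val" where
  "enc_pair ea eb z = VPair (ea (fst z)) (eb (snd z))"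

definition enc_list :: "('a \<Rightarrow> 'k val) \<Rightarrow> 'a list \<Rightarrow> 'k val" where
  "enc_list e xs = list_val (map e xs)"

lemma enc_pair_Pair [simp]: "enc_pair ea eb (x, y) = VPair (ea x) (eb y)"
  by (simp add: enc_pair_def)

lemma enc_list_simps [simp]:
  "enc_list e [] = VNat 0" "enc_list e (x # xs) = VPair (e x) (enc_list e xs)"
  by (simp_all add: enc_list_def)

text \<open>Each \<open>computable_intro\<close> rule treats one head symbol of the body of a function.  Under a binder
  the environment is the pair of the outer and the bound variable.\<close>

named_theorems computable_intro

lemma computableI: "(\<And>x. exec p (ea x) (eb (f x))) \<Longrightarrow> computable ea eb f"
  unfolding computable_def by blast

lemma computableE:
  assumes "computable ea eb f" obtains p where "\<And>x. exec p (ea x) (eb (f x))"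
  using assms unfolding computable_def by blast

lemma c_id [computable_intro]: "computable e e (\<lambda>x. x)"
  by (rule computableI[of Ident]) (rule exec.intros)

lemma c_comp: "computable ea eb f \<Longrightarrow> computable eb ec g \<Longrightarrow> computable ea ec (\<lambda>x. g (f x))"
  by (elim computableE, rule computableI[of "Seq _ _"]) (rule exec.intros)

lemma c_cong: "computable ea eb f \<Longrightarrow> (\<And>x. f x = g x) \<Longrightarrow> computable ea eb g"
  unfolding computable_def by simp

lemma c_comp_prog:
  assumes "computable ea eb f" "\<And>y. exec p (eb y) (ec (g y))"
  shows "computable ea ec (\<lambda>x. g (f x))"
  by (rule c_comp[OF assms(1)], rule computableI) (rule assms(2))

lemma c_Pair [computable_intro]:
  "computable ea eb f \<Longrightarrow> computable ea ec g \<Longrightarrow> computable ea (enc_pair eb ec) (\<lambda>x. (f x, g x))"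
  by (elim computableE, rule computableI, unfold enc_pair_Pair, rule exec.intros)

lemma c_fst [computable_intro]: "computable ea (enc_pair eb ec) f \<Longrightarrow> computable ea eb (\<lambda>x. fst (f x))"
  by (erule c_comp_prog[of _ _ _ First]) (simp add: enc_pair_def exec.intros)

lemma c_snd [computable_intro]: "computable ea (enc_pair eb ec) f \<Longrightarrow> computable ea ec (\<lambda>x. snd (f x))"
  by (erule c_comp_prog[of _ _ _ Second]) (simp add: enc_pair_def exec.intros)

lemma c_comp2:
  assumes "computable (enc_pair e1 e2) e (\<lambda>z. g (fst z) (snd z))" "computable ea e1 f1" "computable ea e2 f2"
  shows "computable ea e (\<lambda>x. g (f1 x) (f2 x))"
  using c_comp[OF c_Pair[OF assms(2,3)] assms(1)] by simp

lemma c_comp3: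
  assumes "computable (enc_pair e1 (enc_pair e2 e3)) e (\<lambda>z. g (fst z) (fst (snd z)) (snd (snd z)))"
    "computable ea e1 f1" "computable ea e2 f2" "computable ea e3 f3"
  shows "computable ea e (\<lambda>x. g (f1 x) (f2 x) (f3 x))"
  using c_comp[OF c_Pair[OF assms(2) c_Pair[OF assms(3,4)]] assms(1)] by simp

lemma c_If [computable_intro]:
  assumes "computable ea enc_bool b" "computable ea eb f" "computable ea eb g"
  shows "computable ea eb (\<lambda>x. if b x then f x else g x)"
proof -
  obtain p q r where p: "\<And>x. exec p (ea x) (enc_bool (b x))" and q: "\<And>x. exec q (ea x) (eb (f x))"
    and r: "\<And>x. exec r (ea x) (eb (g x))"
    using assms unfolding computable_def by blast
  have "exec (Cond p q r) (ea x) (eb (if b x then f x else g x))" for x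
    using p[of x] q[of x] r[of x] by (cases "b x") (auto simp: enc_bool_def intro: exec.intros)
  then show ?thesis by (rule computableI)
qed

section \<open>Truth values, field operations and loops\<close>

lemma c_0 [computable_intro]: "computable ea VNat (\<lambda>x. 0)"
  by (rule computableI[of Zero]) (rule exec.intros)

lemma c_Suc [computable_intro]: "computable ea VNat f \<Longrightarrow> computable ea VNat (\<lambda>x. Suc (f x))"
  by (erule c_comp_prog[of _ _ _ Succ]) (metis Suc_eq_plus1 exec.intros(14))

lemma c_1 [computable_intro]: "computable ea VNat (\<lambda>x. 1)"
  unfolding One_nat_def by (rule computable_intro)+

lemma c_pred: "computable ea VNat f \<Longrightarrow> computable ea VNat (\<lambda>x. f x - 1)"
  by (erule c_comp_prog[of _ _ _ Pred]) (rule exec.intros)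

lemma c_True [computable_intro]: "computable ea enc_bool (\<lambda>x. True)"
  using c_1[of ea] by (simp add: computable_def enc_bool_def)

lemma c_False [computable_intro]: "computable ea enc_bool (\<lambda>x. False)"
  using c_0[of ea] by (simp add: computable_def enc_bool_def)

lemma c_nonzero: "computable ea VNat f \<Longrightarrow> computable ea enc_bool (\<lambda>x. f x \<noteq> 0)"
proof (erule c_comp_prog)
  fix n :: nat
  \<comment> \<open>Any nonzero number counts as true in a test, but \<open>enc_bool\<close> admits
    only 0 and 1, so the value is normalized.\<close>
  show "exec (Cond Ident (Seq Zero Succ) Zero) (VNat n) (enc_bool (n \<noteq> 0))"
    using exec.intros(14)[of 0] by (cases "n = 0") (auto simp: enc_bool_def intro: exec.intros)
qed

lemma c_not [computable_intro]:
  assumes "computable ea enc_bool b" shows "computable ea enc_bool (\<lambda>x. \<not> b x)"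
proof -
  have "computable ea enc_bool (\<lambda>x. if b x then False else True)" by (rule assms computable_intro)+
  moreover have "(\<lambda>x. if b x then False else True) = (\<lambda>x. \<not> b x)" by auto
  ultimately show ?thesis by simp
qed

lemma c_conj [computable_intro]:
  assumes "computable ea enc_bool b" "computable ea enc_bool c"
  shows "computable ea enc_bool (\<lambda>x. b x \<and> c x)"
proof -
  have "computable ea enc_bool (\<lambda>x. if b x then c x else False)" by (rule assms computable_intro)+
  moreover have "(\<lambda>x. if b x then c x else False) = (\<lambda>x. b x \<and> c x)" by auto
  ultimately show ?thesis by simp
qed

lemma c_disj [computable_intro]:
  assumes "computable ea enc_bool b" "computable ea enc_bool c"
  shows "computable ea enc_bool (\<lambda>x. b x \<or> c x)"
proof -
  have "computable ea enc_bool (\<lambda>x. if b x then True else c x)" by (rule assms computable_intro)+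
  moreover have "(\<lambda>x. if b x then True else c x) = (\<lambda>x. b x \<or> c x)" by auto
  ultimately show ?thesis by simp
qed

lemma c_zero_elem [computable_intro]: "computable ea VElem (\<lambda>x. 0)"
  by (rule computableI[of FZero]) (rule exec.intros)

lemma c_add_elem [computable_intro]:
  "computable ea VElem f \<Longrightarrow> computable ea VElem g \<Longrightarrow> computable ea VElem (\<lambda>x. f x + g x)"
  by (rule c_comp2[of VElem VElem], rule computableI, unfold enc_pair_def, rule exec.intros)

lemma c_mult_elem [computable_intro]:
  "computable ea VElem f \<Longrightarrow> computable ea VElem g \<Longrightarrow> computable ea VElem (\<lambda>x. f x * g x)"
  by (rule c_comp2[of VElem VElem], rule computableI, unfold enc_pair_def, rule exec.intros)

lemma c_uminus_elem [computable_intro]: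
  "computable ea VElem f \<Longrightarrow> computable ea VElem (\<lambda>x. - f x)"
  by (erule c_comp_prog[of _ _ _ FNeg]) (rule exec.intros)

lemma c_eq_elem [computable_intro]:
  "computable ea VElem f \<Longrightarrow> computable ea VElem g \<Longrightarrow> computable ea enc_bool (\<lambda>x. f x = g x)"
  by (rule c_comp2[of VElem VElem], rule computableI, unfold enc_pair_def enc_bool_def, rule exec.intros)

text \<open>The program loops on the pair of environment and state; \<open>Fork First pc\<close>
  copies the environment unchanged in every round.\<close>

lemma c_while:
  assumes "computable ea es s"
    and "computable (enc_pair ea es) enc_bool (\<lambda>z. b (fst z) (snd z))"
    and "computable (enc_pair ea es) es (\<lambda>z. c (fst z) (snd z))"
    and "\<And>x. \<exists>t. while_option (b x) (c x) (s x) = Some t"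
  shows "computable ea es (\<lambda>x. while (b x) (c x) (s x))"
proof -
  obtain ps pb pc where ps: "\<And>x. exec ps (ea x) (es (s x))"
    and pb': "\<And>z. exec pb (enc_pair ea es z) (enc_bool (b (fst z) (snd z)))"
    and pc': "\<And>z. exec pc (enc_pair ea es z) (es (c (fst z) (snd z)))"
    using assms(1-3) unfolding computable_def by blast
  have pb: "exec pb (VPair (ea x) (es t)) (enc_bool (b x t))"
    and pc: "exec pc (VPair (ea x) (es t)) (es (c x t))" for x t
    using pb'[of "(x, t)"] pc'[of "(x, t)"] by simp_all
  let ?W = "While pb (Fork First pc)"
  have "exec (Seq (Fork Ident ps) (Seq ?W Second)) (ea x) (es (while (b x) (c x) (s x)))" for x
  proof -
    obtain t where t: "while_option (b x) (c x) (s x) = Some t" using assms(4) by blast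
    \<comment> \<open>The invariant is in continuation form: \<open>while_option_rule\<close> runs
      forward from the start, whereas derivations of \<open>exec\<close> for \<open>While\<close>
      are built from the last round backwards.\<close>
    have "\<forall>y. exec ?W (VPair (ea x) (es t)) y \<longrightarrow> exec ?W (VPair (ea x) (es (s x))) y"
    proof (rule while_option_rule[OF _ t])
      fix u
      assume u: "\<forall>y. exec ?W (VPair (ea x) (es u)) y \<longrightarrow> exec ?W (VPair (ea x) (es (s x))) y" and "b x u"
      have "exec pb (VPair (ea x) (es u)) (VNat 1)" using pb[of x u] \<open>b x u\<close> by (simp add: enc_bool_def)
      then show "\<forall>y. exec ?W (VPair (ea x) (es (c x u))) y \<longrightarrow> exec ?W (VPair (ea x) (es (s x))) y"
        using u exec.intros(9)[of pb "VPair (ea x) (es u)" 1 "Fork First pc" "VPair (ea x) (es (c x u))"]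
          pc[of x u] exec.intros by (metis one_neq_zero)
    qed simp
    moreover have "exec pb (VPair (ea x) (es t)) (VNat 0)"
      using pb[of x t] while_option_stop[OF t] by (simp add: enc_bool_def)
    ultimately have "exec ?W (VPair (ea x) (es (s x))) (VPair (ea x) (es t))"
      by (simp add: exec.intros)
    moreover have "while (b x) (c x) (s x) = t" using t by (simp add: while_def)
    ultimately show ?thesis
      using exec.intros(5)[OF exec.intros(4)[OF exec.intros(1) ps] exec.intros(5)[OF _ exec.intros(3)]]
      by simp
  qed
  then show ?thesis by (rule computableI)
qed

text \<open>A counter is decremented next to the state. This bounded iteration yields addition,
  truncated subtraction and comparisons from \<open>Succ\<close> and \<open>Pred\<close>.\<close>

lemma c_funpow:
  assumes "computable ea VNat n" "computable ea es s"
    and "computable (enc_pair ea es) es (\<lambda>z. f (fst z) (snd z))"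
  shows "computable ea es (\<lambda>x. (f x ^^ n x) (s x))"
proof -
  let ?b = "\<lambda>x z. fst z \<noteq> (0::nat)" and ?c = "\<lambda>x z. (fst z - 1, f x (snd z))"
  have while: "while_option (?b x) (?c x) (k, t) = Some (0, (f x ^^ k) t)" for x k t
    by (induction k arbitrary: t) (subst while_option_unfold, simp add: funpow_swap1)+
  have f: "computable (enc_pair ea (enc_pair VNat es)) es (\<lambda>z. f (fst z) (snd (snd z)))"
    by (rule c_comp2[OF assms(3)] computable_intro)+
  have "computable ea (enc_pair VNat es) (\<lambda>x. while (?b x) (?c x) (n x, s x))"
    by (rule c_while) (rule assms(1,2) f c_nonzero c_pred computable_intro exI while)+
  then have "computable ea es (\<lambda>x. snd (while (?b x) (?c x) (n x, s x)))" by (rule c_snd)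
  then show ?thesis using while by (simp add: while_def)
qed

lemma c_add [computable_intro]:
  assumes "computable ea VNat f" "computable ea VNat g" shows "computable ea VNat (\<lambda>x. f x + g x)"
proof -
  have "computable ea VNat (\<lambda>x. (Suc ^^ g x) (f x))" by (rule assms c_funpow computable_intro)+
  then show ?thesis by (simp add: add.commute)
qed

lemma c_minus [computable_intro]:
  assumes "computable ea VNat f" "computable ea VNat g" shows "computable ea VNat (\<lambda>x. f x - g x)"
proof -
  have "computable ea VNat (\<lambda>x. ((\<lambda>k. k - 1) ^^ g x) (f x))" by (rule assms c_funpow c_pred computable_intro)+
  moreover have "((\<lambda>k. k - 1) ^^ n) m = m - n" for m n :: nat by (induction n) simp_all
  ultimately show ?thesis by simp
qed

lemma c_less [computable_intro]:
  assumes "computable ea VNat f" "computable ea VNat g" shows "computable ea enc_bool (\<lambda>x. f x < g x)"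
proof -
  have "computable ea enc_bool (\<lambda>x. g x - f x \<noteq> 0)" by (intro c_nonzero c_minus assms)
  moreover have "(\<lambda>x. g x - f x \<noteq> 0) = (\<lambda>x. f x < g x)" by auto
  ultimately show ?thesis by simp
qed

lemma c_le [computable_intro]:
  assumes "computable ea VNat f" "computable ea VNat g" shows "computable ea enc_bool (\<lambda>x. f x \<le> g x)"
  unfolding not_less[symmetric] by (intro c_not c_less assms)

lemma c_eq_nat [computable_intro]:
  assumes "computable ea VNat f" "computable ea VNat g" shows "computable ea enc_bool (\<lambda>x. f x = g x)"
  unfolding order_eq_iff[of "_ :: nat"] by (intro c_conj c_le assms)

section \<open>List functions\<close>

lemma c_Nil [computable_intro]: "computable ea (enc_list e) (\<lambda>x. [])"
  using c_0[of ea] by (simp add: computable_def)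

lemma c_Cons [computable_intro]:
  assumes "computable ea e f" "computable ea (enc_list e) g"
  shows "computable ea (enc_list e) (\<lambda>x. f x # g x)"
  using c_Pair[OF assms] by (simp add: computable_def)

lemma exec_IsPair: "exec IsPair (VPair x y) (VNat (Suc 0))"
  using exec.intros(10) by simp

lemma c_case_list [computable_intro]:
  assumes "computable ea (enc_list e) l" "computable ea es f"
    and "computable (enc_pair ea (enc_pair e (enc_list e))) es (\<lambda>z. g (fst z) (fst (snd z)) (snd (snd z)))"
  shows "computable ea es (\<lambda>x. case l x of [] \<Rightarrow> f x | y # ys \<Rightarrow> g x y ys)"
proof -
  obtain pl pf pg where pl: "\<And>x. exec pl (ea x) (enc_list e (l x))" and pf: "\<And>x. exec pf (ea x) (es (f x))"
    and pg': "\<And>z. exec pg (enc_pair ea (enc_pair e (enc_list e)) z) (es (g (fst z) (fst (snd z)) (snd (snd z))))"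
    using assms unfolding computable_def by blast
  have pg: "exec pg (VPair (ea x) (VPair (e y) (enc_list e ys))) (es (g x y ys))" for x y ys
    using pg'[of "(x, y, ys)"] by simp
  have "exec (Seq (Fork Ident pl) (Cond (Seq Second IsPair) pg (Seq First pf))) (ea x)
      (es (case l x of [] \<Rightarrow> f x | y # ys \<Rightarrow> g x y ys))" for x
  proof (cases "l x")
    case Nil
    then show ?thesis using pl[of x] pf[of x] by (auto intro!: exec.intros(1-5,7,11))
  next
    case (Cons y ys)
    have "exec (Cond (Seq Second IsPair) pg (Seq First pf)) (VPair (ea x) (VPair (e y) (enc_list e ys)))
        (es (g x y ys))"
      by (rule exec.intros(6)[of _ _ 1]) (auto intro!: pg exec_IsPair exec.intros(3,5))
    then show ?thesis using pl[of x] Cons by (auto intro!: exec.intros(1,4,5))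
  qed
  then show ?thesis by (rule computableI)
qed

text \<open>The loop state holds environment, accumulator and remaining list. The test
  \<open>IsPair\<close> distinguishes a nonempty list from the number that encodes the empty
  one.\<close>

lemma c_foldl [computable_intro]:
  assumes "computable ea (enc_list e) l" "computable ea es s"
    and "computable (enc_pair ea (enc_pair es e)) es (\<lambda>z. f (fst z) (fst (snd z)) (snd (snd z)))"
  shows "computable ea es (\<lambda>x. foldl (f x) (s x) (l x))"
proof -
  obtain pl ps pf where pl: "\<And>x. exec pl (ea x) (enc_list e (l x))" and ps: "\<And>x. exec ps (ea x) (es (s x))"
    and pf': "\<And>z. exec pf (enc_pair ea (enc_pair es e) z) (es (f (fst z) (fst (snd z)) (snd (snd z))))"
    using assms unfolding computable_def by blast
  have pf: "exec pf (VPair (ea x) (VPair (es t) (e y))) (es (f x t y))" for x t y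
    using pf'[of "(x, t, y)"] by simp
  let ?test = "Seq Second (Seq Second IsPair)"
  let ?head = "Seq Second (Seq Second First)" and ?tail = "Seq Second (Seq Second Second)"
  let ?body = "Fork First (Fork (Seq (Fork First (Fork (Seq Second First) ?head)) pf) ?tail)"
  let ?state = "\<lambda>x t ys. VPair (ea x) (VPair (es t) (enc_list e ys))"
  have body: "exec ?body (?state x t (y # ys)) (?state x (f x t y) ys)" for x t y ys
    using pf[of x t y] by (auto intro!: exec.intros(2-5))
  have test: "exec ?test (?state x t ys) (VNat (if ys = [] then 0 else 1))" for x t ys
    by (cases ys) (auto intro!: exec_IsPair exec.intros(3,5,11))
  have loop: "exec (While ?test ?body) (?state x t ys) (?state x (foldl (f x) t ys) [])" for x t ys
  proof (induction ys arbitrary: t)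
    case Nil
    then show ?case using test[of x t "[]"] by (auto intro: exec.intros(8))
  next
    case (Cons y ys)
    have "exec ?test (?state x t (y # ys)) (VNat 1)" using test[of x t "y # ys"] by simp
    then show ?case unfolding foldl_Cons by (rule exec.intros(9)[OF _ one_neq_zero body Cons.IH])
  qed
  have "exec (Seq (Fork Ident (Fork ps pl)) (Seq (While ?test ?body) (Seq Second First))) (ea x)
      (es (foldl (f x) (s x) (l x)))" for x
    by (rule exec.intros(5)[OF exec.intros(4)[OF exec.intros(1) exec.intros(4)[OF ps pl]]
          exec.intros(5)[OF loop exec.intros(5)[OF exec.intros(3) exec.intros(2)]]])
  then show ?thesis by (rule computableI)
qed

lemma c_rev:
  assumes "computable ea (enc_list e) l" shows "computable ea (enc_list e) (\<lambda>x. rev (l x))"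
proof -
  have c: "computable ea (enc_list e) (\<lambda>x. foldl (\<lambda>ys y. y # ys) [] (l x))"
    by (rule assms computable_intro)+
  have eq: "foldl (\<lambda>ys y. y # ys) zs xs = rev xs @ zs" for xs zs
    by (induction xs arbitrary: zs) simp_all
  from c show ?thesis by (rule c_cong) (simp add: eq)
qed

lemma c_foldr [computable_intro]:
  assumes "computable ea (enc_list e) l" "computable ea es s"
    and "computable (enc_pair ea (enc_pair es e)) es (\<lambda>z. f (fst z) (snd (snd z)) (fst (snd z)))"
  shows "computable ea es (\<lambda>x. foldr (f x) (l x) (s x))"
  unfolding foldr_conv_foldl by (rule assms c_foldl c_rev)+

lemma c_append [computable_intro]:
  assumes "computable ea (enc_list e) f" "computable ea (enc_list e) g"
  shows "computable ea (enc_list e) (\<lambda>x. f x @ g x)"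
proof -
  have c: "computable ea (enc_list e) (\<lambda>x. foldr (#) (f x) (g x))"
    by (rule assms computable_intro)+
  have eq: "foldr (#) xs ys = xs @ ys" for xs ys by (induction xs) simp_all
  from c show ?thesis by (rule c_cong) (simp add: eq)
qed

lemma c_concat [computable_intro]:
  assumes "computable ea (enc_list (enc_list e)) f"
  shows "computable ea (enc_list e) (\<lambda>x. concat (f x))"
  unfolding concat_conv_foldr by (rule assms computable_intro)+

lemma c_map [computable_intro]:
  assumes "computable ea (enc_list e) l" "computable (enc_pair ea e) e' (\<lambda>z. f (fst z) (snd z))"
  shows "computable ea (enc_list e') (\<lambda>x. map (f x) (l x))"
proof -
  have c: "computable ea (enc_list e') (\<lambda>x. foldr (\<lambda>y ys. f x y # ys) (l x) [])"
    by (rule assms(1) c_comp2[OF assms(2)] computable_intro)+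
  have eq: "foldr (\<lambda>y ys. g y # ys) xs [] = map g xs" for g xs
    by (induction xs) simp_all
  from c show ?thesis by (rule c_cong) (simp add: eq)
qed

lemma c_filter [computable_intro]:
  assumes "computable ea (enc_list e) l" "computable (enc_pair ea e) enc_bool (\<lambda>z. P (fst z) (snd z))"
  shows "computable ea (enc_list e) (\<lambda>x. filter (P x) (l x))"
proof -
  have c: "computable ea (enc_list e) (\<lambda>x. foldr (\<lambda>y ys. if P x y then y # ys else ys) (l x) [])"
    by (rule assms(1) c_comp2[OF assms(2)] computable_intro)+
  have eq: "foldr (\<lambda>y ys. if Q y then y # ys else ys) xs [] = filter Q xs" for Q xs
    by (induction xs) simp_all
  from c show ?thesis by (rule c_cong) (simp add: eq)
qed

lemma c_list_all [computable_intro]: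
  assumes "computable ea (enc_list e) l" "computable (enc_pair ea e) enc_bool (\<lambda>z. P (fst z) (snd z))"
  shows "computable ea enc_bool (\<lambda>x. list_all (P x) (l x))"
proof -
  have c: "computable ea enc_bool (\<lambda>x. foldr (\<lambda>y b. P x y \<and> b) (l x) True)"
    by (rule assms(1) c_comp2[OF assms(2)] computable_intro)+
  have eq: "foldr (\<lambda>y b. Q y \<and> b) xs True = list_all Q xs" for Q xs
    by (induction xs) simp_all
  from c show ?thesis by (rule c_cong) (simp add: eq)
qed

lemma c_list_ex [computable_intro]:
  assumes "computable ea (enc_list e) l" "computable (enc_pair ea e) enc_bool (\<lambda>z. P (fst z) (snd z))"
  shows "computable ea enc_bool (\<lambda>x. list_ex (P x) (l x))"
proof -
  have c: "computable ea enc_bool (\<lambda>x. foldr (\<lambda>y b. P x y \<or> b) (l x) False)"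
    by (rule assms(1) c_comp2[OF assms(2)] computable_intro)+
  have eq: "foldr (\<lambda>y b. Q y \<or> b) xs False = list_ex Q xs" for Q xs
    by (induction xs) simp_all
  from c show ?thesis by (rule c_cong) (simp add: eq)
qed

lemma c_is_Nil [computable_intro]:
  assumes "computable ea (enc_list e) l" shows "computable ea enc_bool (\<lambda>x. l x = [])"
proof -
  have c: "computable ea enc_bool (\<lambda>x. case l x of [] \<Rightarrow> True | y # ys \<Rightarrow> False)"
    by (rule assms computable_intro)+
  from c show ?thesis by (rule c_cong) (simp split: list.split)
qed

lemma c_length [computable_intro]:
  assumes "computable ea (enc_list e) l" shows "computable ea VNat (\<lambda>x. length (l x))"
proof -
  have c: "computable ea VNat (\<lambda>x. foldr (\<lambda>y. Suc) (l x) 0)" by (rule assms computable_intro)+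
  have eq: "foldr (\<lambda>y. Suc) xs 0 = length xs" for xs by (induction xs) simp_all
  from c show ?thesis by (rule c_cong) (simp add: eq)
qed

lemma c_sum_list [computable_intro]:
  fixes l :: "'a \<Rightarrow> nat list"
  assumes "computable ea (enc_list VNat) l" shows "computable ea VNat (\<lambda>x. sum_list (l x))"
  unfolding sum_list.eq_foldr by (rule assms computable_intro)+

lemma c_sum_list_elem [computable_intro]:
  assumes "computable ea (enc_list VElem) l" shows "computable ea VElem (\<lambda>x. sum_list (l x))"
  unfolding sum_list.eq_foldr by (rule assms computable_intro)+

lemma c_upt [computable_intro]:
  assumes "computable ea VNat n" shows "computable ea (enc_list VNat) (\<lambda>x. [0..<n x])"
proof -
  \<comment> \<open>The length of the list built so far is the next entry, so no separate counter is
    needed in the state.\<close>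
  have c: "computable ea (enc_list VNat) (\<lambda>x. ((\<lambda>l. l @ [length l]) ^^ n x) [])"
    by (rule assms c_funpow computable_intro)+
  have eq: "((\<lambda>l. l @ [length l]) ^^ k) [] = [0..<k]" for k by (induction k) simp_all
  from c show ?thesis by (rule c_cong) (simp add: eq)
qed

lemma c_nth_default [computable_intro]:
  assumes "computable ea (enc_list VNat) f" "computable ea VNat n"
  shows "computable ea VNat (\<lambda>x. nth_default 0 (f x) (n x))"
proof -
  let ?tl = "\<lambda>l. case l of [] \<Rightarrow> [] | y # ys \<Rightarrow> ys"
  have c: "computable ea VNat (\<lambda>x. case (?tl ^^ n x) (f x) of [] \<Rightarrow> 0 | y # ys \<Rightarrow> y)"
    by (rule assms c_funpow computable_intro)+
  have eq: "(case (?tl ^^ k) xs of [] \<Rightarrow> 0 | y # ys \<Rightarrow> y) = nth_default (0::nat) xs k" for k xs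
    by (induction k arbitrary: xs) (auto simp: funpow_swap1 split: list.split)
  from c show ?thesis by (rule c_cong) (rule eq)
qed

lemma c_n_lists [computable_intro]:
  assumes "computable ea VNat n" "computable ea (enc_list e) xs"
  shows "computable ea (enc_list (enc_list e)) (\<lambda>x. List.n_lists (n x) (xs x))"
proof -
  \<comment> \<open>The list \<open>xs\<close> is used beneath one and two binders, where the
    environment has been extended and has to be projected away.\<close>
  have xs: "computable (enc_pair ea e') (enc_list e) (\<lambda>z. xs (fst z))"
    "computable (enc_pair (enc_pair ea e') e'') (enc_list e) (\<lambda>z. xs (fst (fst z)))" for e' e''
    by (rule c_comp[OF _ assms(2)] computable_intro)+
  have c: "computable ea (enc_list (enc_list e))
      (\<lambda>x. ((\<lambda>ls. concat (map (\<lambda>l. map (\<lambda>y. y # l) (xs x)) ls)) ^^ n x) [[]])"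
    by (rule assms(1) xs c_funpow computable_intro)+
  have eq: "((\<lambda>ls. concat (map (\<lambda>l. map (\<lambda>y. y # l) ys) ls)) ^^ k) [[]] = List.n_lists k ys" for k ys
    by (induction k) simp_all
  from c show ?thesis by (rule c_cong) (rule eq)
qed


section \<open>Polynomials as lists of terms\<close>

text \<open>No normal form of the lists is maintained: coefficients are computed by summation and exponents
  beyond the end of a list are \<open>0\<close>, so none of the operations needs an invariant.\<close>

type_synonym 'k terms = "('k \<times> nat list) list"

abbreviation enc_terms :: "'k terms \<Rightarrow> 'k val" where
  "enc_terms \<equiv> enc_list (enc_pair VElem (enc_list VNat))"

lemma enc_terms_eq: "enc_terms = (\<lambda>ts. list_val (map term_val ts))"
  by (auto simp: fun_eq_iff enc_list_def enc_pair_def term_val_def split: prod.split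
      intro!: arg_cong[of _ _ list_val])

text \<open>Every admissible presentation is literally the encoding of a list of term lists, so a
  computable function on such lists handles all presentations of the input.\<close>

lemma encodes_polysE:
  assumes "encodes_polys v fs"
  obtains G where "v = enc_list enc_terms G" "fs = map poly_of_terms G"
proof -
  obtain vs where vs: "v = list_val vs" "list_all2 encodes_poly vs fs"
    using assms by (auto simp: encodes_polys_def)
  have "\<exists>G. vs = map enc_terms G \<and> fs = map poly_of_terms G"
    using vs(2)
  proof induction
    case (Cons v vs f fs)
    then obtain G ts where "vs = map enc_terms G" "fs = map poly_of_terms G"
      "v = enc_terms ts" "f = poly_of_terms ts" by (auto simp: encodes_poly_def enc_terms_eq)
    then show ?case by (intro exI[of _ "ts # G"]) simp
  qed simp
  then obtain G where G: "vs = map enc_terms G" "fs = map poly_of_terms G" by blast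
  have "v = enc_list enc_terms G" by (simp only: vs(1) G(1) enc_list_def[of enc_terms])
  then show thesis using G(2) by (rule that)
qed

lemma encodes_polys_enc_list: "encodes_polys (enc_list enc_terms G) (map poly_of_terms G)"
proof -
  have "list_all2 encodes_poly (map enc_terms G) (map poly_of_terms G)"
    unfolding list_all2_map1 list_all2_map2 enc_terms_eq by (rule list_all2_refl) (auto simp: encodes_poly_def)
  then show ?thesis unfolding encodes_polys_def enc_list_def[of enc_terms] by blast
qed

text \<open>The sum of the lengths is a convenient bound covering both lists; beyond it both
  exponents are 0.\<close>

definition exp_eq :: "nat list \<Rightarrow> nat list \<Rightarrow> bool" where
  "exp_eq es fs = list_all (\<lambda>i. nth_default 0 es i = nth_default 0 fs i) [0..<length es + length fs]"

definition exp_dvd :: "nat list \<Rightarrow> nat list \<Rightarrow> bool" where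
  "exp_dvd es fs = list_all (\<lambda>i. nth_default 0 es i \<le> nth_default 0 fs i) [0..<length es]"

definition exp_less :: "nat list \<Rightarrow> nat list \<Rightarrow> bool" where
  "exp_less es fs = list_ex (\<lambda>i. nth_default 0 es i < nth_default 0 fs i \<and>
     list_all (\<lambda>j. j \<le> i \<or> nth_default 0 es j = nth_default 0 fs j) [0..<length es + length fs])
     [0..<length fs]"

definition exp_add :: "nat list \<Rightarrow> nat list \<Rightarrow> nat list" where
  "exp_add es fs = map (\<lambda>i. nth_default 0 es i + nth_default 0 fs i) [0..<length es + length fs]"

definition exp_diff :: "nat list \<Rightarrow> nat list \<Rightarrow> nat list" where
  "exp_diff es fs = map (\<lambda>i. nth_default 0 es i - nth_default 0 fs i) [0..<length es]"

definition exp_perm :: "nat \<Rightarrow> nat list \<Rightarrow> nat list \<Rightarrow> nat list" where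
  "exp_perm m ps es = map (\<lambda>j. sum_list (map (\<lambda>i. if nth_default 0 ps i = j then nth_default 0 es i else 0)
     [0..<length es])) [0..<m]"

definition coef :: "'k::field terms \<Rightarrow> nat list \<Rightarrow> 'k" where
  "coef f es = sum_list (map (\<lambda>t. if exp_eq (snd t) es then fst t else 0) f)"

definition supp :: "'k::field terms \<Rightarrow> nat list list" where
  "supp f = filter (\<lambda>es. coef f es \<noteq> 0) (map snd f)"

text \<open>Several lists in \<open>supp f\<close> may denote the same leading monomial, so the
  first maximal one is taken; \<open>[]\<close> is the default for the zero polynomial.\<close>

definition lead :: "'k::field terms \<Rightarrow> nat list" where
  "lead f = (case filter (\<lambda>es. list_all (\<lambda>fs. \<not> exp_less es fs) (supp f)) (supp f) of
     [] \<Rightarrow> [] | es # _ \<Rightarrow> es)"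

definition mult_term :: "'k::field \<Rightarrow> nat list \<Rightarrow> 'k terms \<Rightarrow> 'k terms" where
  "mult_term c es f = map (\<lambda>t. (c * fst t, exp_add es (snd t))) f"

definition spoly_terms :: "'k::field terms \<Rightarrow> 'k terms \<Rightarrow> 'k terms" where
  "spoly_terms f h = mult_term (coef h (lead h)) (exp_diff (lead h) (lead f)) f @
     mult_term (- coef f (lead f)) (exp_diff (lead f) (lead h)) h"

definition divisors :: "'k::field terms list \<Rightarrow> 'k terms \<Rightarrow> 'k terms list" where
  "divisors H f = filter (\<lambda>h. supp h \<noteq> [] \<and> exp_dvd (lead h) (lead f)) H"

definition div_cond :: "'k::field terms list \<Rightarrow> 'k terms \<Rightarrow> bool" where
  "div_cond H f \<longleftrightarrow> supp f \<noteq> [] \<and> divisors H f \<noteq> []"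

definition div_step :: "'k::field terms list \<Rightarrow> 'k terms \<Rightarrow> 'k terms" where
  "div_step H f = (case divisors H f of [] \<Rightarrow> f | h # _ \<Rightarrow> spoly_terms f h)"

text \<open>Only leading terms are divided. The result is irreducible at its leading monomial, which
  suffices both for the criterion and for termination.\<close>

definition remainder :: "'k::field terms list \<Rightarrow> 'k terms \<Rightarrow> 'k terms" where
  "remainder H f = while (div_cond H) (div_step H) f"

text \<open>A crude upper bound that is easy to compute: the length of every exponent list is one of
  the summands.\<close>

definition num_vars :: "'k terms list \<Rightarrow> nat" where
  "num_vars G = sum_list (map (\<lambda>f. sum_list (map (\<lambda>t. length (snd t)) f)) G)"

definition injections :: "nat \<Rightarrow> nat \<Rightarrow> nat list list" where
  "injections n m = filter (\<lambda>ps. list_all (\<lambda>i. list_all (\<lambda>j. i = j \<or> nth_default 0 ps i \<noteq> nth_default 0 ps j)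
     [0..<length ps]) [0..<length ps]) (List.n_lists n [0..<m])"

definition perm_terms :: "nat \<Rightarrow> nat list \<Rightarrow> 'k terms \<Rightarrow> 'k terms" where
  "perm_terms m ps f = map (\<lambda>t. (fst t, exp_perm m ps (snd t))) f"

text \<open>The sum \<open>num_vars G + num_vars G\<close> is the bound 2N, written with an
  operation already shown computable.\<close>

definition images :: "'k::field terms list \<Rightarrow> 'k terms list" where
  "images G = filter (\<lambda>f. supp f \<noteq> []) (concat (map (\<lambda>ps. map (\<lambda>f. perm_terms (num_vars G + num_vars G) ps f) G)
     (injections (num_vars G) (num_vars G + num_vars G))))"

definition new_remainders :: "'k::field terms list \<Rightarrow> 'k terms list" where
  "new_remainders G = filter (\<lambda>f. supp f \<noteq> []) (concat (map (\<lambda>f. map (\<lambda>h.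
     remainder (images G) (spoly_terms f h)) (images G)) (images G)))"

definition completion :: "'k::field terms list \<Rightarrow> 'k terms list" where
  "completion G = while (\<lambda>G. new_remainders G \<noteq> []) (\<lambda>G. G @ new_remainders G) G"


section \<open>The list operations compute the intended polynomials\<close>

lemma poly_mapping_nth_map_upt:
  assumes "\<And>i. n \<le> i \<Longrightarrow> f i = 0"
  shows "Poly_Mapping.lookup (Poly_Mapping.nth (map f [0..<n])) i = f i"
  using assms[of i] by (simp add: nth_default_def)

lemma nth_default_beyond: "length es \<le> i \<Longrightarrow> nth_default 0 es i = (0::nat)"
  by (simp add: nth_default_def)

lemma exp_eq_iff: "exp_eq es fs \<longleftrightarrow> Poly_Mapping.nth es = Poly_Mapping.nth fs"
proof
  assume eq: "exp_eq es fs"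
  have "nth_default 0 es i = nth_default 0 fs i" for i
    using eq by (cases "i < length es + length fs") (auto simp: exp_eq_def list_all_iff nth_default_beyond)
  then show "Poly_Mapping.nth es = Poly_Mapping.nth fs" by (intro poly_mapping_eqI) simp
next
  assume eq: "Poly_Mapping.nth es = Poly_Mapping.nth fs"
  have "nth_default 0 es i = nth_default 0 fs i" for i
    using arg_cong[OF eq, of "\<lambda>t. Poly_Mapping.lookup t i"] by simp
  then show "exp_eq es fs" by (simp add: exp_eq_def list_all_iff)
qed

lemma exp_dvd_iff: "exp_dvd es fs \<longleftrightarrow> mon_dvd (Poly_Mapping.nth es) (Poly_Mapping.nth fs)"
proof -
  have "exp_dvd es fs \<longleftrightarrow> (\<forall>i. nth_default 0 es i \<le> nth_default 0 fs i)"
    unfolding exp_dvd_def list_all_iff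
    by (auto, metis atLeastLessThan_iff le0 linorder_not_le nth_default_beyond)
  then show ?thesis by (simp add: mon_dvd_iff)
qed

lemma exp_less_iff: "exp_less es fs \<longleftrightarrow> mon_less (Poly_Mapping.nth es) (Poly_Mapping.nth fs)"
proof -
  have "list_all (\<lambda>j. j \<le> i \<or> nth_default 0 es j = nth_default 0 fs j) [0..<length es + length fs] \<longleftrightarrow>
      (\<forall>j>i. nth_default 0 es j = nth_default 0 fs j)" for i
  proof
    assume all: "list_all (\<lambda>j. j \<le> i \<or> nth_default 0 es j = nth_default 0 fs j) [0..<length es + length fs]"
    show "\<forall>j>i. nth_default 0 es j = nth_default 0 fs j"
    proof (intro allI impI)
      fix j assume j: "j > i"
      show "nth_default 0 es j = nth_default 0 fs j"
      proof (cases "j < length es + length fs")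
        case True
        then have "j \<le> i \<or> nth_default 0 es j = nth_default 0 fs j" using all by (simp add: list_all_iff)
        then show ?thesis using j by simp
      qed (simp add: nth_default_beyond)
    qed
  qed (simp add: list_all_iff, meson linorder_not_le)
  moreover have "i < length fs" if "nth_default 0 es i < nth_default 0 fs i" for i
    using that nth_default_beyond[of fs i] by (cases "i < length fs") auto
  ultimately show ?thesis by (auto simp: exp_less_def mon_less_def list_ex_iff)
qed

lemma nth_exp_add: "Poly_Mapping.nth (exp_add es fs) = Poly_Mapping.nth es + Poly_Mapping.nth fs"
  by (rule poly_mapping_eqI) (simp only: exp_add_def, subst poly_mapping_nth_map_upt,
      simp_all add: lookup_add nth_default_beyond)

lemma nth_exp_diff: "Poly_Mapping.nth (exp_diff es fs) = Poly_Mapping.nth es - Poly_Mapping.nth fs"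
  by (rule poly_mapping_eqI) (simp only: exp_diff_def, subst poly_mapping_nth_map_upt,
      simp_all add: lookup_minus nth_default_beyond)

text \<open>Cutting the exponent list at \<open>m\<close> loses nothing, because no occurring index
  is sent to \<open>m\<close> or beyond.\<close>

lemma nth_exp_perm:
  assumes "\<And>i. i < length es \<Longrightarrow> nth_default 0 ps i < m"
  shows "Poly_Mapping.nth (exp_perm m ps es) = perm_mon (nth_default 0 ps) (Poly_Mapping.nth es)"
proof (rule poly_mapping_eqI)
  fix j
  let ?f = "\<lambda>j. \<Sum>i<length es. if nth_default 0 ps i = j then nth_default 0 es i else 0"
  have "exp_perm m ps es = map ?f [0..<m]"
    by (simp add: exp_perm_def sum_list_distinct_conv_sum_set atLeast0LessThan)
  moreover have "?f i = 0" if "m \<le> i" for i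
    using assms that by (intro sum.neutral) force
  ultimately have "Poly_Mapping.lookup (Poly_Mapping.nth (exp_perm m ps es)) j = ?f j"
    by (simp only: poly_mapping_nth_map_upt)
  also have "\<dots> = Poly_Mapping.lookup (perm_mon (nth_default 0 ps) (Poly_Mapping.nth es)) j"
  proof -
    have "Poly_Mapping.keys (Poly_Mapping.nth es) \<subseteq> {..<length es}"
      by (auto simp: in_keys_iff nth_default_def simp del: keys_nth split: if_splits)
    then show ?thesis
      by (simp add: perm_mon_superset[of "{..<length es}"] lookup_sum lookup_single when_def)
  qed
  finally show "Poly_Mapping.lookup (Poly_Mapping.nth (exp_perm m ps es)) j
    = Poly_Mapping.lookup (perm_mon (nth_default 0 ps) (Poly_Mapping.nth es)) j" .
qed

lemma poly_of_terms_simps [simp]: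
  "poly_of_terms [] = 0"
  "poly_of_terms (t # ts) = Poly_Mapping.single (Poly_Mapping.nth (snd t)) (fst t) + poly_of_terms ts"
  "poly_of_terms (ts @ us) = poly_of_terms ts + poly_of_terms us"
  by (simp_all add: poly_of_terms_def case_prod_beta)

lemma coef_eq: "coef f es = Poly_Mapping.lookup (poly_of_terms f) (Poly_Mapping.nth es)"
  by (induction f) (auto simp: coef_def lookup_add lookup_single exp_eq_iff when_def)

lemma keys_poly_of_terms: "Poly_Mapping.keys (poly_of_terms f) \<subseteq> Poly_Mapping.nth ` snd ` set f"
proof (induction f)
  case (Cons t f)
  have "Poly_Mapping.keys (poly_of_terms (t # f)) \<subseteq>
      Poly_Mapping.keys (Poly_Mapping.single (Poly_Mapping.nth (snd t)) (fst t)) \<union> Poly_Mapping.keys (poly_of_terms f)"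
    unfolding poly_of_terms_simps by (rule keys_add)
  then show ?case using Cons by (auto split: if_splits)
qed simp

lemma nth_supp: "Poly_Mapping.nth ` set (supp f) = Poly_Mapping.keys (poly_of_terms f)"
  using keys_poly_of_terms[of f] by (fastforce simp: supp_def coef_eq in_keys_iff)

lemma supp_eq_Nil_iff: "supp f = [] \<longleftrightarrow> poly_of_terms f = 0"
  using nth_supp[of f] by (metis image_is_empty keys_eq_empty set_empty)

text \<open>Every list surviving the filter denotes the leading monomial, and at least one survives,
  so taking the first is correct.\<close>

lemma nth_lead:
  assumes "poly_of_terms f \<noteq> 0" shows "Poly_Mapping.nth (lead f) = lm (poly_of_terms f)"
proof -
  let ?M = "filter (\<lambda>es. list_all (\<lambda>fs. \<not> exp_less es fs) (supp f)) (supp f)"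
  have M: "Poly_Mapping.nth es = lm (poly_of_terms f)" if "es \<in> set ?M" for es
  proof (rule lm_eqI[symmetric])
    show "Poly_Mapping.nth es \<in> Poly_Mapping.keys (poly_of_terms f)" using that nth_supp by auto
    fix u assume "u \<in> Poly_Mapping.keys (poly_of_terms f)"
    then obtain fs where "fs \<in> set (supp f)" "u = Poly_Mapping.nth fs" using nth_supp by blast
    then show "mon_le u (Poly_Mapping.nth es)" using that by (auto simp: list_all_iff exp_less_iff)
  qed
  obtain es where es: "es \<in> set (supp f)" "Poly_Mapping.nth es = lm (poly_of_terms f)"
    using lm_in_keys[OF assms] nth_supp[of f] by (metis imageE)
  have "\<not> exp_less es fs" if "fs \<in> set (supp f)" for fs
  proof -
    have "Poly_Mapping.nth fs \<in> Poly_Mapping.keys (poly_of_terms f)" using that nth_supp by blast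
    then have "mon_le (Poly_Mapping.nth fs) (Poly_Mapping.nth es)" unfolding es(2) by (rule lm_ge[OF assms])
    then show ?thesis by (simp add: exp_less_iff mon.not_less)
  qed
  then have "es \<in> set ?M" using es(1) by (simp add: list_all_iff)
  then obtain fs gs where "?M = fs # gs" by (metis list.distinct(1) list.exhaust empty_iff set_empty)
  then have "lead f \<in> set ?M" unfolding lead_def by (metis list.case(2) list.set_intros(1))
  then show ?thesis by (rule M)
qed

lemma poly_mult_term:
  "poly_of_terms (mult_term c es f) = Poly_Mapping.single (Poly_Mapping.nth es) c * poly_of_terms f"
  by (induction f) (simp_all add: mult_term_def distrib_left mult_single nth_exp_add)

lemma poly_spoly_terms:
  assumes "poly_of_terms f \<noteq> 0" "poly_of_terms h \<noteq> 0"
  shows "poly_of_terms (spoly_terms f h) = spoly (poly_of_terms f) (poly_of_terms h)"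
  using assms by (simp add: spoly_terms_def spoly_def poly_mult_term coef_eq nth_exp_diff nth_lead single_uminus)

lemma poly_perm_terms:
  assumes "\<And>t i. t \<in> set f \<Longrightarrow> i < length (snd t) \<Longrightarrow> nth_default 0 ps i < m"
  shows "poly_of_terms (perm_terms m ps f) = perm_poly (nth_default 0 ps) (poly_of_terms f)"
  using assms
proof (induction f)
  case (Cons t f)
  have "Poly_Mapping.nth (exp_perm m ps (snd t)) = perm_mon (nth_default 0 ps) (Poly_Mapping.nth (snd t))"
    using Cons.prems[of t] by (intro nth_exp_perm) simp
  moreover have "poly_of_terms (perm_terms m ps f) = perm_poly (nth_default 0 ps) (poly_of_terms f)"
    using Cons.prems by (intro Cons.IH) (meson list.set_intros(2))
  ultimately show ?case by (simp add: perm_terms_def perm_poly_add)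
qed (simp add: perm_terms_def)

lemma length_le_num_vars:
  assumes "f \<in> set G" "t \<in> set f" shows "length (snd t) \<le> num_vars G"
proof -
  have "length (snd t) \<le> sum_list (map (\<lambda>t. length (snd t)) f)"
    using assms(2) by (intro member_le_sum_list) auto
  also have "\<dots> \<le> num_vars G"
    unfolding num_vars_def using assms(1) by (intro member_le_sum_list) auto
  finally show ?thesis .
qed

lemma in_vars_num_vars: "f \<in> set G \<Longrightarrow> in_vars (num_vars G) (poly_of_terms f)"
  unfolding in_vars_def
proof (intro ballI subsetI)
  fix t i assume f: "f \<in> set G" and "t \<in> Poly_Mapping.keys (poly_of_terms f)" and i: "i \<in> Poly_Mapping.keys t"
  then obtain u where u: "u \<in> set f" "t = Poly_Mapping.nth (snd u)" using keys_poly_of_terms by blast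
  then have "i < length (snd u)" using i by (auto simp: in_keys_iff nth_default_def simp del: keys_nth split: if_splits)
  then show "i \<in> {..<num_vars G}" using length_le_num_vars[OF f u(1)] by simp
qed

lemma set_injections: "set (injections n m) = {ps. length ps = n \<and> distinct ps \<and> set ps \<subseteq> {..<m}}"
proof -
  have "list_all (\<lambda>i. list_all (\<lambda>j. i = j \<or> nth_default 0 ps i \<noteq> nth_default 0 ps j) [0..<length ps])
      [0..<length ps] \<longleftrightarrow> distinct ps" for ps :: "nat list"
    unfolding list_all_iff distinct_conv_nth set_upt Ball_def atLeastLessThan_iff nth_default_def by auto
  then show ?thesis by (auto simp: injections_def set_n_lists)
qed

text \<open>A list \<open>ps\<close> is read as the map \<open>nth_default 0 ps\<close>, which is
  constantly 0 beyond its length and thus never injective on all indices. This is why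
  \<open>bounded_orbit\<close> asks for injectivity only on \<open>{..<n}\<close>.\<close>

lemma poly_images:
  "poly_of_terms ` set (images G) = bounded_orbit (num_vars G) (2 * num_vars G) (poly_of_terms ` set G)"
proof (intro equalityI subsetI)
  let ?n = "num_vars G"
  fix p assume "p \<in> poly_of_terms ` set (images G)"
  then obtain ps f where ps: "length ps = ?n" "distinct ps" "set ps \<subseteq> {..<2 * ?n}" and f: "f \<in> set G"
    and p: "p = poly_of_terms (perm_terms (2 * ?n) ps f)" "p \<noteq> 0"
    by (auto simp: images_def set_injections supp_eq_Nil_iff mult_2)
  have lt: "nth_default 0 ps i < 2 * ?n" if "i < ?n" for i
    using that ps(1) subsetD[OF ps(3) nth_mem[of i ps]] by (simp add: nth_default_def)
  have "p = perm_poly (nth_default 0 ps) (poly_of_terms f)"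
    unfolding p(1) using lt length_le_num_vars[OF f] by (intro poly_perm_terms) (meson less_le_trans)
  moreover have "inj_on (nth_default 0 ps) {..<?n}"
    using ps(1,2) by (auto simp: inj_on_def nth_default_def nth_eq_iff_index_eq)
  ultimately show "p \<in> bounded_orbit ?n (2 * ?n) (poly_of_terms ` set G)"
    using lt f p(2) by (auto simp: bounded_orbit_def image_subset_iff)
next
  let ?n = "num_vars G"
  fix p assume "p \<in> bounded_orbit ?n (2 * ?n) (poly_of_terms ` set G)"
  then obtain \<sigma> f where \<sigma>: "inj_on \<sigma> {..<?n}" "\<sigma> ` {..<?n} \<subseteq> {..<2 * ?n}" and f: "f \<in> set G"
    and p: "p = perm_poly \<sigma> (poly_of_terms f)" "p \<noteq> 0" by (auto simp: bounded_orbit_def)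
  let ?ps = "map \<sigma> [0..<?n]"
  have nth: "nth_default 0 ?ps i = \<sigma> i" if "i < ?n" for i using that by (simp add: nth_default_def)
  have "p = perm_poly (nth_default 0 ?ps) (poly_of_terms f)"
    unfolding p(1) by (rule in_vars_perm_poly_cong[OF in_vars_num_vars[OF f]]) (simp add: nth)
  also have "\<dots> = poly_of_terms (perm_terms (2 * ?n) ?ps f)"
  proof (rule poly_perm_terms[symmetric])
    fix t i assume "t \<in> set f" "i < length (snd t)"
    then have "i < ?n" using length_le_num_vars[OF f] by (meson less_le_trans)
    then show "nth_default 0 ?ps i < 2 * ?n" using \<sigma>(2) by (auto simp: nth image_subset_iff)
  qed
  finally have p': "p = poly_of_terms (perm_terms (2 * ?n) ?ps f)" .
  have "?ps \<in> set (injections ?n (2 * ?n))"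
    using \<sigma> by (auto simp: set_injections distinct_map atLeast0LessThan)
  then have "perm_terms (2 * ?n) ?ps f \<in> set (images G)"
    using f p(2) p' by (auto simp: images_def supp_eq_Nil_iff mult_2)
  then show "p \<in> poly_of_terms ` set (images G)" using p' by blast
qed


section \<open>The completion procedure\<close>

lemma div_stepE:
  assumes "div_cond H f"
  obtains h where "h \<in> set H" "poly_of_terms f \<noteq> 0" "poly_of_terms h \<noteq> 0"
    "mon_dvd (lm (poly_of_terms h)) (lm (poly_of_terms f))"
    "poly_of_terms (div_step H f) = spoly (poly_of_terms f) (poly_of_terms h)"
proof -
  obtain h hs where h: "divisors H f = h # hs" using assms by (cases "divisors H f") (auto simp: div_cond_def)
  have "h \<in> set (divisors H f)" by (simp add: h)
  then have "h \<in> set H" "poly_of_terms h \<noteq> 0" "exp_dvd (lead h) (lead f)"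
    by (simp_all add: divisors_def supp_eq_Nil_iff)
  moreover have "poly_of_terms f \<noteq> 0" using assms by (simp add: div_cond_def supp_eq_Nil_iff)
  ultimately show thesis
    using that[of h] by (simp add: exp_dvd_iff nth_lead div_step_def h poly_spoly_terms)
qed

lemma remainder_terminates: "\<exists>r. while_option (div_cond H) (div_step H) f = Some r"
proof -
  \<comment> \<open>The zero polynomial has no meaningful leading monomial, so a first component
    ranks it below all others.\<close>
  let ?m = "\<lambda>f. (if poly_of_terms f = 0 then 0 else 1 :: nat, lm (poly_of_terms f))"
  have "wf (inv_image (less_than <*lex*> {(s, t). mon_less s t}) ?m)"
    using wf_mon_less by (intro wf_inv_image wf_lex_prod) (simp_all add: wfp_def)
  then show ?thesis
  proof (rule wf_rel_while_option_Some[where P = "\<lambda>_. True"])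
    fix f assume "True \<and> div_cond H f"
    then obtain h where "poly_of_terms f \<noteq> 0" "poly_of_terms h \<noteq> 0"
      "mon_dvd (lm (poly_of_terms h)) (lm (poly_of_terms f))"
      "poly_of_terms (div_step H f) = spoly (poly_of_terms f) (poly_of_terms h)"
      by (elim conjE div_stepE)
    then show "(div_step H f, f) \<in> inv_image (less_than <*lex*> {(s, t). mon_less s t}) ?m"
      using lm_spoly_less by auto
  qed simp_all
qed

lemma remainder_invariant:
  assumes "\<And>f. P f \<Longrightarrow> div_cond H f \<Longrightarrow> P (div_step H f)" "P f"
  shows "P (remainder H f)"
proof -
  obtain r where r: "while_option (div_cond H) (div_step H) f = Some r" using remainder_terminates by blast
  have "P r" by (rule while_option_rule[where P = P, OF assms(1) r assms(2)])
  then show ?thesis using r by (simp add: remainder_def while_def)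
qed

lemma not_div_cond_remainder: "\<not> div_cond H (remainder H f)"
proof -
  obtain r where r: "while_option (div_cond H) (div_step H) f = Some r" using remainder_terminates by blast
  then show ?thesis using while_option_stop[OF r] by (simp add: remainder_def while_def)
qed

text \<open>Representations are rebuilt from the end of the division. The loop runs forward, so its
  invariant is an implication: a bounded representation of the current dividend yields one of
  \<open>f\<close>.\<close>

lemma rep_of_remainder_eq_0:
  assumes "poly_of_terms (remainder H f) = 0" "poly_of_terms ` set H - {0} \<subseteq> B"
  shows "poly_of_terms f = 0 \<or> rep B (\<lambda>s. mon_le s (lm (poly_of_terms f))) (poly_of_terms f)"
proof -
  let ?good = "\<lambda>p. p = 0 \<or> rep B (\<lambda>s. mon_le s (lm p)) p"
  have "?good (poly_of_terms (remainder H f)) \<longrightarrow> ?good (poly_of_terms f)"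
  proof (rule remainder_invariant)
    fix g assume g: "?good (poly_of_terms g) \<longrightarrow> ?good (poly_of_terms f)" and "div_cond H g"
    then obtain h where h: "h \<in> set H" "poly_of_terms g \<noteq> 0" "poly_of_terms h \<noteq> 0"
      "mon_dvd (lm (poly_of_terms h)) (lm (poly_of_terms g))"
      "poly_of_terms (div_step H g) = spoly (poly_of_terms g) (poly_of_terms h)"
      by (elim div_stepE)
    have "poly_of_terms h \<in> B" using h(1,3) assms(2) by auto
    then have "?good (poly_of_terms (div_step H g)) \<longrightarrow> ?good (poly_of_terms g)"
      using rep_of_rep_spoly[OF h(2,3) _ h(4)] unfolding h(5) by blast
    then show "?good (poly_of_terms (div_step H g)) \<longrightarrow> ?good (poly_of_terms f)" using g by blast
  qed simp
  then show ?thesis using assms(1) by simp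
qed

text \<open>All monomials of the S-polynomial lie below the lcm, so they involve no indeterminate
  beyond those of the two leading monomials.\<close>

lemma in_vars_spoly:
  assumes "in_vars n f" "in_vars n h" "f \<noteq> 0" "h \<noteq> 0" shows "in_vars n (spoly f h)"
  unfolding in_vars_def
proof (intro ballI subsetI)
  fix t i assume "t \<in> Poly_Mapping.keys (spoly f h)" and i: "i \<in> Poly_Mapping.keys t"
  then have le: "mon_le t (mon_lcm (lm f) (lm h))" using keys_spoly[OF assms(3,4)] by (meson mon.less_imp_le)
  have "Poly_Mapping.keys (lm f) \<subseteq> {..<n}" "Poly_Mapping.keys (lm h) \<subseteq> {..<n}"
    using assms lm_in_keys by (auto simp: in_vars_def)
  moreover have keys_minus: "Poly_Mapping.keys (lm h - lm f) \<subseteq> Poly_Mapping.keys (lm h)"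
    unfolding subset_iff in_keys_iff lookup_minus by simp
  ultimately have "Poly_Mapping.keys (mon_lcm (lm f) (lm h)) \<subseteq> {..<n}"
    unfolding mon_lcm_def using keys_add[of "lm h - lm f" "lm f"] keys_minus by blast
  then show "i \<in> {..<n}" using mon_keys_below_mono[OF le] i by blast
qed

lemma spoly_in_symmetric_ideal:
  assumes "f \<in> symmetric_ideal_of F" "h \<in> symmetric_ideal_of F"
  shows "spoly f h \<in> symmetric_ideal_of F"
  using assms unfolding symmetric_ideal_of_eq spoly_def by (auto intro: rep_diff rep_mult)

text \<open>Images use at most \<open>2 * num_vars G\<close> indeterminates and are closed neither
  under S-polynomials nor division, but both operations stay within these indeterminates and within
  the ideal. Irreducibility holds because the division loop has stopped.\<close>

lemma
  assumes "r \<in> set (new_remainders G)"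
  shows new_remainder_neq_0: "poly_of_terms r \<noteq> 0"
    and new_remainder_in_vars: "in_vars (2 * num_vars G) (poly_of_terms r)"
    and new_remainder_irreducible:
      "p \<in> poly_of_terms ` set (images G) \<Longrightarrow> \<not> mon_dvd (lm p) (lm (poly_of_terms r))"
    and new_remainder_in_ideal:
      "poly_of_terms ` set (images G) \<subseteq> symmetric_ideal_of F \<Longrightarrow> poly_of_terms r \<in> symmetric_ideal_of F"
proof -
  let ?H = "images G"
  obtain f h where f: "f \<in> set ?H" and h: "h \<in> set ?H" and r: "r = remainder ?H (spoly_terms f h)"
    and "poly_of_terms r \<noteq> 0"
    using assms by (auto simp: new_remainders_def supp_eq_Nil_iff)
  show ne: "poly_of_terms r \<noteq> 0" by fact
  have H_ne: "poly_of_terms g \<noteq> 0" if "g \<in> set ?H" for g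
    using that by (auto simp: images_def supp_eq_Nil_iff)
  have H_vars: "in_vars (2 * num_vars G) (poly_of_terms g)" if g: "g \<in> set ?H" for g
  proof -
    have "poly_of_terms g \<in> bounded_orbit (num_vars G) (2 * num_vars G) (poly_of_terms ` set G)"
      using g poly_images by blast
    then obtain \<sigma> p where "p \<in> set G" "\<sigma> ` {..<num_vars G} \<subseteq> {..<2 * num_vars G}"
      "poly_of_terms g = perm_poly \<sigma> (poly_of_terms p)" by (auto simp: bounded_orbit_def)
    then show ?thesis using in_vars_perm_poly[OF in_vars_num_vars] by metis
  qed
  show "in_vars (2 * num_vars G) (poly_of_terms r)"
    unfolding r
  proof (rule remainder_invariant)
    fix g assume "in_vars (2 * num_vars G) (poly_of_terms g)" "div_cond ?H g"
    then show "in_vars (2 * num_vars G) (poly_of_terms (div_step ?H g))"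
      by (elim div_stepE) (simp add: in_vars_spoly H_vars)
  qed (simp add: poly_spoly_terms f h H_ne in_vars_spoly H_vars)
  show "\<not> mon_dvd (lm p) (lm (poly_of_terms r))" if p: "p \<in> poly_of_terms ` set ?H"
  proof
    assume dvd: "mon_dvd (lm p) (lm (poly_of_terms r))"
    obtain g where g: "g \<in> set ?H" "p = poly_of_terms g" using p by blast
    then have "g \<in> set (divisors ?H r)"
      using dvd ne H_ne by (simp add: divisors_def supp_eq_Nil_iff exp_dvd_iff nth_lead)
    then have "div_cond ?H r" using ne by (auto simp: div_cond_def supp_eq_Nil_iff)
    then show False using not_div_cond_remainder r by blast
  qed
  show "poly_of_terms r \<in> symmetric_ideal_of F"
    if sub: "poly_of_terms ` set ?H \<subseteq> symmetric_ideal_of F"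
    unfolding r
  proof (rule remainder_invariant)
    fix g assume "poly_of_terms g \<in> symmetric_ideal_of F" "div_cond ?H g"
    then show "poly_of_terms (div_step ?H g) \<in> symmetric_ideal_of F"
      using sub by (elim div_stepE) (auto intro: spoly_in_symmetric_ideal)
  next
    show "poly_of_terms (spoly_terms f h) \<in> symmetric_ideal_of F"
      using sub f h by (auto simp: poly_spoly_terms H_ne intro: spoly_in_symmetric_ideal)
  qed
qed

text \<open>If the loop ran forever, Higman's lemma would give rounds \<open>i < j\<close> and a map
  \<open>\<pi>\<close> sending the leading monomial of \<open>r i\<close> to a divisor of that of
  \<open>r j\<close>. Since \<open>r i\<close> belongs to the list of round \<open>j\<close>, it
  remains to realize \<open>\<pi>\<close> on \<open>r i\<close> by an admissible image; then
  \<open>r j\<close> would be reducible.\<close>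

lemma completion_terminates:
  "\<exists>t. while_option (\<lambda>G. new_remainders G \<noteq> []) (\<lambda>G. G @ new_remainders G) G = Some t"
proof (rule ccontr)
  let ?c = "\<lambda>G. G @ new_remainders G"
  assume none: "\<not> ?thesis"
  \<comment> \<open>Divergence of \<open>while_option\<close> means that the loop condition holds at
    every iterate.\<close>
  have more: "new_remainders ((?c ^^ k) G) \<noteq> []" for k
    using none unfolding while_option_def by (auto split: if_splits)
  define r where "r k = hd (new_remainders ((?c ^^ k) G))" for k
  have r: "r k \<in> set (new_remainders ((?c ^^ k) G))" for k using more[of k] by (simp add: r_def)
  have old: "r i \<in> set ((?c ^^ j) G)" if "i < j" for i j
    using that by (induction j) (use r in \<open>auto simp: less_Suc_eq\<close>)
  define m where "m k = lm (poly_of_terms (r k))" for k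
  obtain i j \<pi> where ij: "i < j" and \<pi>: "strict_mono \<pi>" "mon_dvd (perm_mon \<pi> (m i)) (m j)"
    and bound: "\<forall>n. Poly_Mapping.keys (m j) \<subseteq> {..<n} \<longrightarrow> (\<forall>k\<in>Poly_Mapping.keys (m i). \<forall>l\<le>k. \<pi> l < n)"
    by (rule higman_mon[of m])
  define Gj where "Gj = (?c ^^ j) G"
  let ?n = "num_vars Gj" and ?p = "poly_of_terms (r i)"
  have rj: "r j \<in> set (new_remainders Gj)" and ri: "r i \<in> set Gj"
    using r old[OF ij] by (simp_all add: Gj_def)
  have p: "?p \<noteq> 0" using r by (rule new_remainder_neq_0)
  have "Poly_Mapping.keys (m j) \<subseteq> {..<2 * ?n}"
    using new_remainder_in_vars[OF rj] lm_in_keys[OF new_remainder_neq_0[OF rj]] by (simp add: in_vars_def m_def)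
  then have bound: "\<forall>k\<in>Poly_Mapping.keys (m i). \<forall>l\<le>k. \<pi> l < 2 * ?n" using bound by simp
  \<comment> \<open>\<open>d\<close> is one more than the largest index in \<open>m i\<close>, or 0
    when \<open>m i\<close> is the monomial 1.\<close>
  obtain d where d: "Poly_Mapping.keys (m i) \<subseteq> {..<d}" "\<pi> ` {..<d} \<subseteq> {..<2 * ?n}"
  proof (cases "Poly_Mapping.keys (m i) = {}")
    case True
    then show ?thesis using that[of 0] by simp
  next
    case False
    then have "Max (Poly_Mapping.keys (m i)) \<in> Poly_Mapping.keys (m i)" by simp
    then have "\<forall>l\<le>Max (Poly_Mapping.keys (m i)). \<pi> l < 2 * ?n" using bound by blast
    then show ?thesis
      by (intro that[of "Suc (Max (Poly_Mapping.keys (m i)))"]) (auto simp: less_Suc_eq_le simp del: Max_less_iff)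
  qed
  have inj: "inj \<pi>" using \<pi>(1) by (rule strict_mono_imp_inj_on)
  \<comment> \<open>\<open>\<pi>\<close> need not send all of \<open>{..<?n}\<close> below
    \<open>2 * ?n\<close>. The extension \<open>\<psi>\<close> preserves \<open>{..<2 * ?n}\<close>
    and agrees with \<open>\<pi>\<close> on the indeterminates of \<open>r i\<close>, so it gives
    the same image and is admissible.\<close>
  obtain \<psi> where \<psi>: "bij \<psi>" "\<And>i. i < d \<Longrightarrow> \<psi> i = \<pi> i" "\<And>i. i < 2 * ?n \<Longrightarrow> \<psi> i < 2 * ?n"
    by (rule ex_bij_extending[OF inj_on_subset[OF inj subset_UNIV] d(2)]) blast
  have "in_vars d ?p"
    using lm_ge[OF p] mon_keys_below_mono[OF _ d(1)] by (auto simp: in_vars_def m_def)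
  then have eq: "perm_poly \<psi> ?p = perm_poly \<pi> ?p" by (rule in_vars_perm_poly_cong) (rule \<psi>(2))
  have "perm_poly \<psi> ?p \<noteq> 0" using p perm_poly_eq_0_iff[OF bij_is_inj[OF \<psi>(1)], of ?p] by simp
  moreover have "\<psi> ` {..<?n} \<subseteq> {..<2 * ?n}" using \<psi>(3) by auto
  moreover have "inj_on \<psi> {..<?n}" using bij_is_inj[OF \<psi>(1)] by (rule inj_on_subset) simp
  ultimately have "perm_poly \<psi> ?p \<in> bounded_orbit ?n (2 * ?n) (poly_of_terms ` set Gj)"
    using ri by (auto simp: bounded_orbit_def)
  then have "perm_poly \<pi> ?p \<in> poly_of_terms ` set (images Gj)" by (simp only: poly_images eq)
  then have "\<not> mon_dvd (lm (perm_poly \<pi> ?p)) (m j)"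
    unfolding m_def by (rule new_remainder_irreducible[OF rj])
  then show False using \<pi>(2) by (simp add: lm_perm_poly[OF \<pi>(1) p] m_def)
qed

lemma bounded_orbit_subset_symmetric_ideal:
  fixes F :: "'k::field rpoly set"
  assumes "\<And>g. g \<in> G \<Longrightarrow> in_vars n g" "G \<subseteq> symmetric_ideal_of F"
  shows "bounded_orbit n m G \<subseteq> symmetric_ideal_of F"
proof
  fix b assume "b \<in> bounded_orbit n m G"
  then have "b \<in> sym_orbit G" using bounded_orbit_subset[OF assms(1)] by blast
  then obtain \<sigma> g where \<sigma>: "b = perm_poly \<sigma> g" "inj \<sigma>" "g \<in> G" by (auto simp: sym_orbit_def)
  then have "rep (sym_orbit F) (\<lambda>_. True) g" using assms(2) by (auto simp: symmetric_ideal_of_eq)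
  then have "rep (sym_orbit F) (\<lambda>_. True) b"
    unfolding \<sigma>(1) by (rule rep_perm_poly) (simp add: perm_poly_sym_orbit[OF \<sigma>(2)])
  then show "b \<in> symmetric_ideal_of F" by (simp add: symmetric_ideal_of_eq)
qed

text \<open>The loop keeps the current list between the input and the ideal it generates, so the
  ideal never changes. At the exit, absence of new remainders certifies the S-polynomials of all
  bounded pairs.\<close>

theorem normal_form_images_completion:
  fixes G :: "'k::field terms list"
  shows "f \<in> symmetric_ideal_of (poly_of_terms ` set G) \<longleftrightarrow>
    normal_form (poly_of_terms ` set (images (completion G))) f 0"
proof -
  let ?I = "symmetric_ideal_of (poly_of_terms ` set G)" and ?C = "completion G"
  let ?N = "num_vars ?C" and ?G = "poly_of_terms ` set ?C"
  obtain t where t: "while_option (\<lambda>G. new_remainders G \<noteq> []) (\<lambda>G. G @ new_remainders G) G = Some t"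
    using completion_terminates by blast
  then have C: "?C = t" by (simp add: completion_def while_def)
  have no_new: "new_remainders ?C = []" using while_option_stop[OF t] C by simp
  have "poly_of_terms ` set G \<subseteq> ?G \<and> ?G \<subseteq> ?I"
    unfolding C
  proof (rule while_option_rule[OF _ t])
    show "poly_of_terms ` set G \<subseteq> poly_of_terms ` set G \<and> poly_of_terms ` set G \<subseteq> ?I"
      by (simp add: symmetric_ideal_of_def hull_subset)
    fix E assume E: "poly_of_terms ` set G \<subseteq> poly_of_terms ` set E \<and> poly_of_terms ` set E \<subseteq> ?I"
    have "poly_of_terms ` set (images E) \<subseteq> ?I"
      unfolding poly_images using E by (intro bounded_orbit_subset_symmetric_ideal) (auto simp: in_vars_num_vars)
    then have "poly_of_terms r \<in> ?I" if "r \<in> set (new_remainders E)" for r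
      using that by (rule new_remainder_in_ideal[rotated])
    then show "poly_of_terms ` set G \<subseteq> poly_of_terms ` set (E @ new_remainders E) \<and>
        poly_of_terms ` set (E @ new_remainders E) \<subseteq> ?I" using E by auto
  qed
  then have sub: "poly_of_terms ` set G \<subseteq> ?G" "?G \<subseteq> ?I" by simp_all
  have eq: "symmetric_ideal_of ?G = ?I"
  proof
    show "symmetric_ideal_of ?G \<subseteq> ?I"
      unfolding symmetric_ideal_of_def[of ?G]
      using sub(2) symmetric_ideal_rep_sym_orbit unfolding symmetric_ideal_of_eq by (rule hull_minimal)
    show "?I \<subseteq> symmetric_ideal_of ?G"
      unfolding symmetric_ideal_of_def using sub(1) by (rule hull_mono)
  qed
  interpret bounded_buchberger ?N ?G
  proof
    show "in_vars ?N g" if "g \<in> ?G" for g using that in_vars_num_vars by blast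
    let ?H = "bounded_orbit ?N (2 * ?N) ?G"
    fix p q assume "p \<in> ?H" "q \<in> ?H"
    then obtain f h where f: "f \<in> set (images ?C)" "p = poly_of_terms f"
      and h: "h \<in> set (images ?C)" "q = poly_of_terms h" unfolding poly_images[symmetric] by blast
    have ne: "p \<noteq> 0" "q \<noteq> 0" using f h by (auto simp: images_def supp_eq_Nil_iff)
    \<comment> \<open>Zero remainders are filtered out of \<open>new_remainders\<close>, so an empty
      list means that every pair leaves remainder 0.\<close>
    have "remainder (images ?C) (spoly_terms f h) \<notin> set (new_remainders ?C)" by (simp add: no_new)
    then have "poly_of_terms (remainder (images ?C) (spoly_terms f h)) = 0"
      using f(1) h(1) unfolding new_remainders_def supp_eq_Nil_iff by auto
    then have "spoly p q = 0 \<or> rep ?H (\<lambda>s. mon_le s (lm (spoly p q))) (spoly p q)"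
      using rep_of_remainder_eq_0[of "images ?C" "spoly_terms f h" ?H] ne
      by (auto simp: poly_images poly_spoly_terms f(2) h(2))
    then show "rep ?H (\<lambda>s. mon_less s (mon_lcm (lm p) (lm q))) (spoly p q)"
    proof
      assume rep: "rep ?H (\<lambda>s. mon_le s (lm (spoly p q))) (spoly p q)"
      show ?thesis
      proof (cases "spoly p q = 0")
        case False
        have "mon_less (lm (spoly p q)) (mon_lcm (lm p) (lm q))"
          using keys_spoly[OF ne lm_in_keys[OF False]] .
        then show ?thesis using mon.le_less_trans by (intro rep_mono[OF rep]) blast
      qed (simp add: rep_zero)
    qed (simp add: rep_zero)
  qed
  have "f \<in> symmetric_ideal_of ?G \<longleftrightarrow> normal_form H f 0" by (rule normal_form_iff)
  then show ?thesis by (simp only: eq poly_images)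
qed


section \<open>Computability of the completion\<close>

text \<open>\<open>c_comp2\<close> first replaces the arguments by projections of a pair; the
  unfolded body is then assembled by the introduction rules alone. The following lemmas use the same
  scheme.\<close>

lemma c_exp_eq [computable_intro]:
  assumes "computable ea (enc_list VNat) f" "computable ea (enc_list VNat) g"
  shows "computable ea enc_bool (\<lambda>x. exp_eq (f x) (g x))"
  by (rule c_comp2[OF _ assms], unfold exp_eq_def) (rule computable_intro)+

lemma c_exp_dvd [computable_intro]:
  assumes "computable ea (enc_list VNat) f" "computable ea (enc_list VNat) g"
  shows "computable ea enc_bool (\<lambda>x. exp_dvd (f x) (g x))"
  by (rule c_comp2[OF _ assms], unfold exp_dvd_def) (rule computable_intro)+

lemma c_exp_less [computable_intro]:
  assumes "computable ea (enc_list VNat) f" "computable ea (enc_list VNat) g"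
  shows "computable ea enc_bool (\<lambda>x. exp_less (f x) (g x))"
  by (rule c_comp2[OF _ assms], unfold exp_less_def) (rule computable_intro)+

lemma c_exp_add [computable_intro]:
  assumes "computable ea (enc_list VNat) f" "computable ea (enc_list VNat) g"
  shows "computable ea (enc_list VNat) (\<lambda>x. exp_add (f x) (g x))"
  by (rule c_comp2[OF _ assms], unfold exp_add_def) (rule computable_intro)+

lemma c_exp_diff [computable_intro]:
  assumes "computable ea (enc_list VNat) f" "computable ea (enc_list VNat) g"
  shows "computable ea (enc_list VNat) (\<lambda>x. exp_diff (f x) (g x))"
  by (rule c_comp2[OF _ assms], unfold exp_diff_def) (rule computable_intro)+

lemma c_exp_perm [computable_intro]:
  assumes "computable ea VNat m" "computable ea (enc_list VNat) f" "computable ea (enc_list VNat) g"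
  shows "computable ea (enc_list VNat) (\<lambda>x. exp_perm (m x) (f x) (g x))"
  by (rule c_comp3[OF _ assms], unfold exp_perm_def) (rule computable_intro)+

lemma c_coef [computable_intro]:
  assumes "computable ea enc_terms f" "computable ea (enc_list VNat) g"
  shows "computable ea VElem (\<lambda>x. coef (f x) (g x))"
  by (rule c_comp2[OF _ assms], unfold coef_def) (rule computable_intro)+

lemma c_supp [computable_intro]:
  assumes "computable ea enc_terms f"
  shows "computable ea (enc_list (enc_list VNat)) (\<lambda>x. supp (f x))"
  by (rule c_comp[OF assms], unfold supp_def) (rule computable_intro)+

lemma c_lead [computable_intro]:
  assumes "computable ea enc_terms f"
  shows "computable ea (enc_list VNat) (\<lambda>x. lead (f x))"
  by (rule c_comp[OF assms], unfold lead_def) (rule computable_intro)+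

lemma c_mult_term [computable_intro]:
  assumes "computable ea VElem c" "computable ea (enc_list VNat) g" "computable ea enc_terms f"
  shows "computable ea enc_terms (\<lambda>x. mult_term (c x) (g x) (f x))"
  by (rule c_comp3[OF _ assms], unfold mult_term_def) (rule computable_intro)+

lemma c_spoly_terms [computable_intro]:
  assumes "computable ea enc_terms f" "computable ea enc_terms g"
  shows "computable ea enc_terms (\<lambda>x. spoly_terms (f x) (g x))"
  by (rule c_comp2[OF _ assms], unfold spoly_terms_def) (rule computable_intro)+

lemma c_divisors [computable_intro]:
  assumes "computable ea (enc_list enc_terms) f" "computable ea enc_terms g"
  shows "computable ea (enc_list enc_terms) (\<lambda>x. divisors (f x) (g x))"
  by (rule c_comp2[OF _ assms], unfold divisors_def) (rule computable_intro)+

lemma c_div_cond [computable_intro]: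
  assumes "computable ea (enc_list enc_terms) f" "computable ea enc_terms g"
  shows "computable ea enc_bool (\<lambda>x. div_cond (f x) (g x))"
  by (rule c_comp2[OF _ assms], unfold div_cond_def) (rule computable_intro)+

lemma c_div_step [computable_intro]:
  assumes "computable ea (enc_list enc_terms) f" "computable ea enc_terms g"
  shows "computable ea enc_terms (\<lambda>x. div_step (f x) (g x))"
  by (rule c_comp2[OF _ assms], unfold div_step_def) (rule computable_intro)+

lemma c_remainder [computable_intro]:
  assumes "computable ea (enc_list enc_terms) f" "computable ea enc_terms g"
  shows "computable ea enc_terms (\<lambda>x. remainder (f x) (g x))"
  by (rule c_comp2[OF _ assms], unfold remainder_def) (rule c_while computable_intro remainder_terminates)+

lemma c_num_vars [computable_intro]:
  assumes "computable ea (enc_list enc_terms) f"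
  shows "computable ea VNat (\<lambda>x. num_vars (f x))"
  by (rule c_comp[OF assms], unfold num_vars_def) (rule computable_intro)+

lemma c_injections [computable_intro]:
  assumes "computable ea VNat n" "computable ea VNat m"
  shows "computable ea (enc_list (enc_list VNat)) (\<lambda>x. injections (n x) (m x))"
  by (rule c_comp2[OF _ assms], unfold injections_def) (rule computable_intro)+

lemma c_perm_terms [computable_intro]:
  assumes "computable ea VNat m" "computable ea (enc_list VNat) g" "computable ea enc_terms f"
  shows "computable ea enc_terms (\<lambda>x. perm_terms (m x) (g x) (f x))"
  by (rule c_comp3[OF _ assms], unfold perm_terms_def) (rule computable_intro)+

lemma c_images [computable_intro]:
  assumes "computable ea (enc_list enc_terms) f"
  shows "computable ea (enc_list enc_terms) (\<lambda>x. images (f x))"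
  by (rule c_comp[OF assms], unfold images_def) (rule computable_intro)+

lemma c_new_remainders [computable_intro]:
  assumes "computable ea (enc_list enc_terms) f"
  shows "computable ea (enc_list enc_terms) (\<lambda>x. new_remainders (f x))"
  by (rule c_comp[OF assms], unfold new_remainders_def) (rule computable_intro)+

lemma c_completion [computable_intro]:
  assumes "computable ea (enc_list enc_terms) f"
  shows "computable ea (enc_list enc_terms) (\<lambda>x. completion (f x))"
  by (rule c_comp[OF assms], unfold completion_def) (rule c_while computable_intro completion_terminates)+

text \<open>The output is the list of bounded images of the completed generators, not the generators
  alone: a witness mimics a strictly increasing map on the relevant indices, so the rearranged
  copies must already be present.\<close>

theorem theorem1p6:
  shows "\<exists>p :: prog. \<forall>(fs :: 'k::field rpoly list) v. encodes_polys v fs \<longrightarrow>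
    (\<exists>gs w. exec p v w \<and> encodes_polys w gs \<and> 0 \<notin> set gs \<and>
       (\<forall>f. f \<in> symmetric_ideal_of (set fs) \<longleftrightarrow> normal_form (set gs) f 0))"
proof -
  let ?enc = "enc_list enc_terms :: 'k terms list \<Rightarrow> 'k val"
  have "computable ?enc ?enc (\<lambda>G. images (completion G))" by (rule computable_intro)+
  then obtain p where p: "\<And>G. exec p (?enc G) (?enc (images (completion G)))"
    unfolding computable_def by blast
  show ?thesis
  proof (intro exI[of _ p] allI impI)
    fix fs :: "'k rpoly list" and v assume "encodes_polys v fs"
    then obtain G where G: "v = ?enc G" "fs = map poly_of_terms G" by (rule encodes_polysE)
    let ?H = "images (completion G)"
    have "0 \<notin> set (map poly_of_terms ?H)" by (auto simp: images_def supp_eq_Nil_iff)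
    moreover have "\<forall>f. f \<in> symmetric_ideal_of (set fs) \<longleftrightarrow> normal_form (set (map poly_of_terms ?H)) f 0"
      unfolding G(2) set_map using normal_form_images_completion by blast
    ultimately show "\<exists>gs w. exec p v w \<and> encodes_polys w gs \<and> 0 \<notin> set gs \<and>
       (\<forall>f. f \<in> symmetric_ideal_of (set fs) \<longleftrightarrow> normal_form (set gs) f 0)"
      using p[of G] encodes_polys_enc_list[of ?H] G(1) by blast
  qed
qed

end
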